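(* Let $E$ be a Dedekind complete real Banach lattice. Take $S,T\in\mathcal Z(E_{\mathbb C})$. For a norm bounded, not necessarily order bounded, linear operator $\Xi$ on $E_{\mathbb C}$, the following are equivalent: (1) $S\,\Xi=\Xi\,T$; (2) $\overline S\,\Xi=\Xi\,\overline T$.
   Context: Operators are linear; $I$ denotes the identity operator. For a Dedekind complete real Banach lattice $E$, the complexification $E_{\mathbb C}=E+iE$ carries the modulus $|x+iy|=\sup_{\theta\in[0,2\pi]}(x\cos\theta+y\sin\theta)$ and the norm $\lVert z\rVert=\lVert\,|z|\,\rVert$. $L_r(E)$ is the Dedekind complete vector lattice of regular operators on $E$ (differences of positive operators). $L_r(E_{\mathbb C})=L_r(E)+iL_r(E)$ is its complexification, acting on $E_{\mathbb C}$ in the obvious way; for $T=A+iB$ with $A,B\in L_r(E)$, $|T|=\sup_\theta(A\cos\theta+B\sin\theta)\in L_r(E)$ and $\overline T=A-iB$. The centre of $E_{\mathbb C}$ is $\mathcal Z(E_{\mathbb C})=\{T\in L_r(E_{\mathbb C}): |T|\le\lambda I\text{ for some }\lambda\ge0\}$. *)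

theory Defs
  imports "HOL-Analysis.Analysis" "HOL-Library.Lattice_Algebras"
begin

section \<open>Dedekind complete vector lattices and Banach lattices\<close>

text \<open>In class \<^class>\<open>conditionally_complete_lattice\<close> every nonempty set that is bounded
  above (below) has a supremum (infimum): this is Dedekind completeness.\<close>

class dedekind_complete_vector_lattice =
  ordered_real_vector + lattice_ab_group_add + conditionally_complete_lattice

text \<open>In the lattice norm axiom, \<open>sup x (- x)\<close> is the absolute value of \<open>x\<close>.\<close>

class dedekind_complete_banach_lattice = dedekind_complete_vector_lattice + banach +
  assumes norm_lattice_mono: "sup x (- x) \<le> sup y (- y) \<Longrightarrow> norm x \<le> norm y"

instance real :: dedekind_complete_vector_lattice ..

instance real :: dedekind_complete_banach_lattice
  by standard (simp add: sup_max max_def split: if_splits)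

section \<open>Complexification\<close>

text \<open>The same construction serves for a vector lattice \<open>E\<close> and for the vector lattice of regular
  operators on \<open>E\<close>.  Elements \<open>Complexify x y\<close> stand for \<open>x + i y\<close>.\<close>

datatype 'a complexification = Complexify (re_part: 'a) (im_part: 'a)

instantiation complexification :: (ab_group_add) ab_group_add
begin

definition "0 = Complexify 0 0"
definition "z + w = Complexify (re_part z + re_part w) (im_part z + im_part w)"
definition "- z = Complexify (- re_part z) (- im_part z)"
definition "z - w = Complexify (re_part z - re_part w) (im_part z - im_part w)"

instance
  by standard
    (auto simp: zero_complexification_def plus_complexification_def uminus_complexification_def
      minus_complexification_def algebra_simps complexification.expand)

end

definition scaleC :: "complex \<Rightarrow> 'a::real_vector complexification \<Rightarrow> 'a complexification" where
  "scaleC c z = Complexify (Re c *\<^sub>R re_part z - Im c *\<^sub>R im_part z)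
                           (Re c *\<^sub>R im_part z + Im c *\<^sub>R re_part z)"

lemma vector_space_scaleC: "vector_space (scaleC :: complex \<Rightarrow> 'a::real_vector complexification \<Rightarrow> _)"
  by standard
    (auto simp: scaleC_def plus_complexification_def algebra_simps)

definition cnj_c :: "'a::ab_group_add complexification \<Rightarrow> 'a complexification" where
  "cnj_c z = Complexify (re_part z) (- im_part z)"

definition modulus :: "'a::dedekind_complete_vector_lattice complexification \<Rightarrow> 'a" where
  "modulus z = (SUP \<theta>\<in>{0..2 * pi}. cos \<theta> *\<^sub>R re_part z + sin \<theta> *\<^sub>R im_part z)"

text \<open>The set in the definition of \<^const>\<open>modulus\<close> is bounded above, so its supremum exists.\<close>

lemma scaleR_le_sup_uminus:
  fixes x :: "'a::dedekind_complete_vector_lattice"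
  assumes "\<bar>c\<bar> \<le> 1"
  shows "c *\<^sub>R x \<le> sup x (- x)"
proof -
  let ?a = "sup x (- x)"
  have "x + - x \<le> ?a + ?a" by (intro add_mono) auto
  then have a: "0 \<le> ?a" by simp
  have "c *\<^sub>R x \<le> \<bar>c\<bar> *\<^sub>R ?a"
  proof (cases "0 \<le> c")
    case True
    then show ?thesis by (simp add: scaleR_left_mono)
  next
    case False
    then have "(- c) *\<^sub>R (- x) \<le> (- c) *\<^sub>R ?a" by (intro scaleR_left_mono) auto
    with False show ?thesis by simp
  qed
  also have "\<dots> \<le> 1 *\<^sub>R ?a" by (rule scaleR_right_mono[OF assms a])
  finally show ?thesis by simp
qed

lemma modulus_bdd_above:
  fixes z :: "'a::dedekind_complete_vector_lattice complexification"
  shows "bdd_above ((\<lambda>\<theta>. cos \<theta> *\<^sub>R re_part z + sin \<theta> *\<^sub>R im_part z) ` A)"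
  by (rule bdd_aboveI2, rule add_mono; rule scaleR_le_sup_uminus) simp_all

definition norm_c :: "'a::dedekind_complete_banach_lattice complexification \<Rightarrow> real" where
  "norm_c z = norm (modulus z)"

section \<open>The vector lattice of regular operators\<close>

definition positive_operator :: "('a::dedekind_complete_vector_lattice \<Rightarrow> 'a) \<Rightarrow> bool" where
  "positive_operator P \<longleftrightarrow> linear P \<and> (\<forall>x\<ge>0. 0 \<le> P x)"

definition regular_operator :: "('a::dedekind_complete_vector_lattice \<Rightarrow> 'a) \<Rightarrow> bool" where
  "regular_operator A \<longleftrightarrow>
     (\<exists>P Q. positive_operator P \<and> positive_operator Q \<and> A = (\<lambda>x. P x - Q x))"

lemma positive_operator_zero: "positive_operator (\<lambda>_. 0)"
  by (simp add: positive_operator_def linear_iff)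

lemma positive_operator_ident: "positive_operator (\<lambda>x. x)"
  by (simp add: positive_operator_def linear_iff)

lemma positive_operator_add:
  "positive_operator P \<Longrightarrow> positive_operator Q \<Longrightarrow> positive_operator (\<lambda>x. P x + Q x)"
  by (simp add: positive_operator_def linear_compose_add)

lemma positive_operator_scale:
  "0 \<le> c \<Longrightarrow> positive_operator P \<Longrightarrow> positive_operator (\<lambda>x. c *\<^sub>R P x)"
  by (simp add: positive_operator_def linear_compose_scale_right scaleR_nonneg_nonneg)

lemma positive_imp_regular: "positive_operator P \<Longrightarrow> regular_operator P"
  unfolding regular_operator_def
  by (intro exI[of _ P] exI[of _ "\<lambda>_. 0"]) (simp add: positive_operator_zero)

lemma regular_operator_linear: "regular_operator A \<Longrightarrow> linear A"
  by (auto simp: regular_operator_def positive_operator_def intro: linear_compose_sub)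

lemma regular_operator_uminus: "regular_operator A \<Longrightarrow> regular_operator (\<lambda>x. - A x)"
  unfolding regular_operator_def by (metis minus_diff_eq)

lemma regular_operator_add:
  assumes "regular_operator A" "regular_operator B"
  shows "regular_operator (\<lambda>x. A x + B x)"
proof -
  obtain P Q P' Q' where "positive_operator P" "positive_operator Q" "positive_operator P'"
    "positive_operator Q'" and eq: "A = (\<lambda>x. P x - Q x)" "B = (\<lambda>x. P' x - Q' x)"
    using assms unfolding regular_operator_def by blast
  then have "positive_operator (\<lambda>x. P x + P' x)" "positive_operator (\<lambda>x. Q x + Q' x)"
    by (simp_all add: positive_operator_add)
  moreover have "(\<lambda>x. A x + B x) = (\<lambda>x. (P x + P' x) - (Q x + Q' x))"
    by (simp add: eq algebra_simps)
  ultimately show ?thesis unfolding regular_operator_def by blast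
qed

lemma regular_operator_scale:
  assumes "regular_operator A"
  shows "regular_operator (\<lambda>x. c *\<^sub>R A x)"
proof -
  have *: "regular_operator (\<lambda>x. d *\<^sub>R A x)" if "0 \<le> d" for d
  proof -
    obtain P Q where "positive_operator P" "positive_operator Q" and eq: "A = (\<lambda>x. P x - Q x)"
      using assms unfolding regular_operator_def by blast
    then have "positive_operator (\<lambda>x. d *\<^sub>R P x)" "positive_operator (\<lambda>x. d *\<^sub>R Q x)"
      using that by (simp_all add: positive_operator_scale)
    moreover have "(\<lambda>x. d *\<^sub>R A x) = (\<lambda>x. d *\<^sub>R P x - d *\<^sub>R Q x)"
      by (simp add: eq scaleR_diff_right)
    ultimately show ?thesis unfolding regular_operator_def by blast
  qed
  show ?thesis
    using *[of c] regular_operator_uminus[OF *[of "- c"]] by (cases "0 \<le> c") auto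
qed

typedef (overloaded) 'a regop = "{A :: 'a::dedekind_complete_vector_lattice \<Rightarrow> 'a. regular_operator A}"
  morphisms app_regop Abs_regop
  using positive_imp_regular[OF positive_operator_zero] by blast

setup_lifting type_definition_regop

instantiation regop :: (dedekind_complete_vector_lattice) real_vector
begin

lift_definition zero_regop :: "'a regop" is "\<lambda>_. 0"
  by (rule positive_imp_regular[OF positive_operator_zero])
lift_definition plus_regop :: "'a regop \<Rightarrow> 'a regop \<Rightarrow> 'a regop" is "\<lambda>A B x. A x + B x"
  by (rule regular_operator_add)
lift_definition uminus_regop :: "'a regop \<Rightarrow> 'a regop" is "\<lambda>A x. - A x"
  by (rule regular_operator_uminus)
lift_definition minus_regop :: "'a regop \<Rightarrow> 'a regop \<Rightarrow> 'a regop" is "\<lambda>A B x. A x - B x"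
  using regular_operator_add[OF _ regular_operator_uminus] by fastforce
lift_definition scaleR_regop :: "real \<Rightarrow> 'a regop \<Rightarrow> 'a regop" is "\<lambda>c A x. c *\<^sub>R A x"
  by (rule regular_operator_scale)

instance
  by standard (transfer; simp add: algebra_simps fun_eq_iff)+

end

lift_definition id_regop :: "'a::dedekind_complete_vector_lattice regop" is "\<lambda>x. x"
  by (rule positive_imp_regular[OF positive_operator_ident])

text \<open>The operator order: \<open>A \<le> B\<close> iff \<open>B - A\<close> is positive.\<close>

lemma linear_eq_on_cone:
  fixes A B :: "'a::dedekind_complete_vector_lattice \<Rightarrow> 'a"
  assumes "linear A" "linear B" "\<And>x. 0 \<le> x \<Longrightarrow> A x = B x"
  shows "A = B"
proof
  fix x
  have "A x = A (pprt x - (- nprt x))" using prts[of x] by simp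
  also have "\<dots> = B (pprt x - (- nprt x))"
    using assms(3)[of "pprt x"] assms(3)[of "- nprt x"]
    by (simp only: linear_diff[OF assms(1)] linear_diff[OF assms(2)]) simp
  also have "\<dots> = B x" using prts[of x] by simp
  finally show "A x = B x" .
qed

instantiation regop :: (dedekind_complete_vector_lattice) ordered_real_vector
begin

lift_definition less_eq_regop :: "'a regop \<Rightarrow> 'a regop \<Rightarrow> bool" is
  "\<lambda>A B. \<forall>x\<ge>0. A x \<le> B x" .
definition less_regop :: "'a regop \<Rightarrow> 'a regop \<Rightarrow> bool" where
  "less_regop A B \<longleftrightarrow> A \<le> B \<and> \<not> B \<le> A"

instance
proof
  fix A B C :: "'a regop" and a b :: real
  show "A < B \<longleftrightarrow> A \<le> B \<and> \<not> B \<le> A" by (rule less_regop_def)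
  show "A \<le> A" by transfer simp
  show "A \<le> B \<Longrightarrow> B \<le> C \<Longrightarrow> A \<le> C" by transfer (meson order_trans)
  show "A \<le> B \<Longrightarrow> B \<le> A \<Longrightarrow> A = B"
    by transfer (rule linear_eq_on_cone; simp add: regular_operator_linear order.antisym)
  show "A \<le> B \<Longrightarrow> C + A \<le> C + B" by transfer simp
  show "A \<le> B \<Longrightarrow> 0 \<le> a \<Longrightarrow> a *\<^sub>R A \<le> a *\<^sub>R B"
    by transfer (simp add: scaleR_left_mono)
  show "a \<le> b \<Longrightarrow> 0 \<le> A \<Longrightarrow> a *\<^sub>R A \<le> b *\<^sub>R A"
    by transfer (simp add: scaleR_right_mono)
qed

end

text \<open>Suprema of operators, after Riesz and Kantorovich: on the positive cone, the supremum of a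
  set \<open>F\<close> of operators maps \<open>x\<close> to the supremum of the sums \<open>T\<^sub>1 x\<^sub>1 + \<dots> + T\<^sub>n x\<^sub>n\<close> with \<open>T\<^sub>i \<in> F\<close>,
  \<open>x\<^sub>i \<ge> 0\<close> and \<open>x\<^sub>1 + \<dots> + x\<^sub>n = x\<close>.\<close>

inductive_set rk_sums :: "('a::dedekind_complete_vector_lattice \<Rightarrow> 'a) set \<Rightarrow> ('a \<times> 'a) set"
  for F where
  nil: "(0, 0) \<in> rk_sums F"
| cons: "T \<in> F \<Longrightarrow> 0 \<le> u \<Longrightarrow> (x, d) \<in> rk_sums F \<Longrightarrow> (u + x, T u + d) \<in> rk_sums F"

lemma rk_sums_nonneg: "(x, d) \<in> rk_sums F \<Longrightarrow> 0 \<le> x"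
  by (induction rule: rk_sums.induct) auto

lemma rk_sums_single: "T \<in> F \<Longrightarrow> 0 \<le> u \<Longrightarrow> (u, T u) \<in> rk_sums F"
  using rk_sums.cons[OF _ _ rk_sums.nil, of T F u] by simp

lemma rk_sums_add:
  "(x, d) \<in> rk_sums F \<Longrightarrow> (y, e) \<in> rk_sums F \<Longrightarrow> (x + y, d + e) \<in> rk_sums F"
  by (induction rule: rk_sums.induct) (auto simp: add.assoc intro: rk_sums.cons)

lemma rk_sums_scale:
  assumes "\<And>T. T \<in> F \<Longrightarrow> linear T" "0 \<le> c"
  shows "(x, d) \<in> rk_sums F \<Longrightarrow> (c *\<^sub>R x, c *\<^sub>R d) \<in> rk_sums F"
proof (induction rule: rk_sums.induct)
  case nil
  then show ?case by (simp add: rk_sums.nil)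
next
  case (cons T u x d)
  then have "(c *\<^sub>R u + c *\<^sub>R x, T (c *\<^sub>R u) + c *\<^sub>R d) \<in> rk_sums F"
    using assms(2) by (intro rk_sums.cons) (auto intro: scaleR_nonneg_nonneg)
  then show ?case
    using linear_scale[OF assms(1)[OF cons.hyps(1)]] by (simp add: scaleR_add_right)
qed

lemma rk_sums_split:
  assumes lin: "\<And>T. T \<in> F \<Longrightarrow> linear T"
  shows "(z, d) \<in> rk_sums F \<Longrightarrow> z = x + y \<Longrightarrow> 0 \<le> x \<Longrightarrow> 0 \<le> y \<Longrightarrow>
    \<exists>d1 d2. (x, d1) \<in> rk_sums F \<and> (y, d2) \<in> rk_sums F \<and> d = d1 + d2"
proof (induction arbitrary: x y rule: rk_sums.induct)
  case nil
  then have "x = 0" "y = 0" by (metis add_nonneg_eq_0_iff)+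
  then show ?case using rk_sums.nil by fastforce
next
  case (cons T u z d)
  have z: "0 \<le> z" using rk_sums_nonneg cons.hyps(3) .
  define v where "v = inf u x"
  have v: "0 \<le> v" "v \<le> u" "v \<le> x" using cons by (auto simp: v_def)
  have "u - y \<le> v" unfolding v_def
    using cons.prems(3) z cons.prems(1)
    by (auto simp: diff_le_eq) (metis add.commute le_add_same_cancel1)
  then have w: "u - v \<le> y" by (simp add: algebra_simps)
  have "z = (x - v) + (y - (u - v))" using cons.prems(1) by (simp add: algebra_simps)
  from cons.IH[OF this] v w obtain d1 d2 where
    d: "(x - v, d1) \<in> rk_sums F" "(y - (u - v), d2) \<in> rk_sums F" "d = d1 + d2"
    by auto
  have "(v + (x - v), T v + d1) \<in> rk_sums F" "((u - v) + (y - (u - v)), T (u - v) + d2) \<in> rk_sums F"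
    using d v cons.hyps(1) by (intro rk_sums.cons; simp)+
  moreover have "T u + d = (T v + d1) + (T (u - v) + d2)"
    by (simp add: linear_diff[OF lin[OF cons.hyps(1)]] d(3))
  ultimately show ?case by (metis add.commute diff_add_cancel)
qed

lemma linear_extension_from_cone:
  fixes g :: "'a::dedekind_complete_vector_lattice \<Rightarrow> 'a"
  assumes add: "\<And>x y. 0 \<le> x \<Longrightarrow> 0 \<le> y \<Longrightarrow> g (x + y) = g x + g y"
    and scale: "\<And>c x. 0 < c \<Longrightarrow> 0 \<le> x \<Longrightarrow> g (c *\<^sub>R x) = c *\<^sub>R g x"
  obtains f where "linear f" "\<And>x. 0 \<le> x \<Longrightarrow> f x = g x"
proof -
  have g0: "g 0 = 0" using add[of 0 0] by simp
  have scale0: "g (c *\<^sub>R x) = c *\<^sub>R g x" if "0 \<le> c" "0 \<le> x" for c x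
    using scale[of c x] that g0 by (cases "c = 0") auto
  define f where "f x = g (pprt x) - g (- nprt x)" for x
  have key: "f (a - b) = g a - g b" if "0 \<le> a" "0 \<le> b" for a b
  proof -
    have "pprt (a - b) + b = a + - nprt (a - b)"
      using prts[of "a - b"] by (simp add: algebra_simps)
    then have "g (pprt (a - b)) + g b = g a + g (- nprt (a - b))"
      using that by (metis add zero_le_pprt nprt_le_zero neg_0_le_iff_le)
    then show ?thesis by (simp add: f_def algebra_simps)
  qed
  have dec: "x = pprt x - (- nprt x)" for x using prts[of x] by simp
  have pos: "0 \<le> pprt x" "0 \<le> - nprt x" for x by auto
  have "linear f"
  proof (rule linearI)
    fix x y
    have "f (x + y) = f ((pprt x + pprt y) - (- nprt x + - nprt y))"
      using prts[of x] prts[of y] by (metis add_diff_add dec)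
    also have "\<dots> = g (pprt x + pprt y) - g (- nprt x + - nprt y)"
      by (intro key add_nonneg_nonneg pos)
    also have "\<dots> = f x + f y"
      by (simp only: add pos f_def) simp
    finally show "f (x + y) = f x + f y" .
  next
    fix c x
    show "f (c *\<^sub>R x) = c *\<^sub>R f x"
    proof (cases "0 \<le> c")
      case True
      have "f (c *\<^sub>R x) = f (c *\<^sub>R pprt x - c *\<^sub>R (- nprt x))"
        using dec[of x] by (metis scaleR_diff_right)
      also have "\<dots> = g (c *\<^sub>R pprt x) - g (c *\<^sub>R (- nprt x))"
        by (intro key scaleR_nonneg_nonneg pos True)
      finally show ?thesis
        by (simp only: scale0 True pos f_def scaleR_diff_right)
    next
      case False
      then have c: "0 \<le> - c" by simp
      have "c *\<^sub>R x = (- c) *\<^sub>R (- nprt x) - (- c) *\<^sub>R pprt x"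
        using arg_cong[OF dec[of x], of "\<lambda>y. c *\<^sub>R y"] by (simp add: algebra_simps)
      then have "f (c *\<^sub>R x) = f ((- c) *\<^sub>R (- nprt x) - (- c) *\<^sub>R pprt x)"
        by (rule arg_cong)
      also have "\<dots> = g ((- c) *\<^sub>R (- nprt x)) - g ((- c) *\<^sub>R pprt x)"
        by (intro key scaleR_nonneg_nonneg pos c)
      also have "\<dots> = (- c) *\<^sub>R g (- nprt x) - (- c) *\<^sub>R g (pprt x)"
        by (simp only: scale0 c pos)
      finally show ?thesis by (simp add: f_def algebra_simps)
    qed
  qed
  moreover have "f x = g x" if "0 \<le> x" for x
    using key[OF that order.refl] g0 by simp
  ultimately show ?thesis using that by blast
qed

lemma regop_has_Sup:
  fixes F :: "'a::dedekind_complete_vector_lattice regop set"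
  assumes ne: "F \<noteq> {}" and bdd: "bdd_above F"
  shows "\<exists>S. (\<forall>T\<in>F. T \<le> S) \<and> (\<forall>V. (\<forall>T\<in>F. T \<le> V) \<longrightarrow> S \<le> V)"
proof -
  define G where "G = app_regop ` F"
  define D where "D x = {d. (x, d) \<in> rk_sums G}" for x
  define g where "g x = Sup (D x)" for x
  have linV: "linear (app_regop V)" for V :: "'a regop"
    using app_regop[of V] by (simp add: regular_operator_linear)
  then have lin: "linear T" if "T \<in> G" for T using that by (auto simp: G_def)
  have bound: "d \<le> app_regop V x" if "\<forall>T\<in>F. T \<le> V" "(x, d) \<in> rk_sums G" for V x d
    using that(2)
  proof (induction rule: rk_sums.induct)
    case nil
    then show ?case using linear_0[OF linV] by simp
  next
    case (cons T u x d)
    then have "T u \<le> app_regop V u"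
      using that(1) by (auto simp: G_def less_eq_regop.rep_eq)
    then show ?case using cons.IH by (simp add: linear_add[OF linV] add_mono)
  qed
  obtain U where U: "\<forall>T\<in>F. T \<le> U" using bdd by (auto simp: bdd_above_def)
  have bddD: "bdd_above (D x)" for x
    using bound[OF U] by (auto simp: D_def intro!: bdd_aboveI)
  have neD: "D x \<noteq> {}" if "0 \<le> x" for x
    using ne rk_sums_single[OF _ that, of _ G] by (force simp: D_def G_def)
  have le_g: "d \<le> g x" if "(x, d) \<in> rk_sums G" for x d
    unfolding g_def using that bddD by (intro cSup_upper) (auto simp: D_def)
  have g_le: "g x \<le> c" if "0 \<le> x" "\<And>d. (x, d) \<in> rk_sums G \<Longrightarrow> d \<le> c" for x c
    unfolding g_def using that neD by (intro cSup_least) (auto simp: D_def)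
  have g_add: "g (x + y) = g x + g y" if x: "0 \<le> x" and y: "0 \<le> y" for x y
  proof (rule antisym)
    show "g (x + y) \<le> g x + g y"
    proof (rule g_le)
      fix d assume "(x + y, d) \<in> rk_sums G"
      from rk_sums_split[OF lin this refl x y] obtain d1 d2 where
        "(x, d1) \<in> rk_sums G" "(y, d2) \<in> rk_sums G" "d = d1 + d2" by blast
      then show "d \<le> g x + g y" by (simp add: add_mono le_g)
    qed (use x y in simp)
    have "d \<le> g (x + y) - g y" if d: "(x, d) \<in> rk_sums G" for d
    proof -
      have "e \<le> g (x + y) - d" if "(y, e) \<in> rk_sums G" for e
        using le_g[OF rk_sums_add[OF d that]] by (simp add: algebra_simps)
      then have "g y \<le> g (x + y) - d" by (rule g_le[OF y])
      then show ?thesis by (simp add: algebra_simps)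
    qed
    then have "g x \<le> g (x + y) - g y" by (rule g_le[OF x])
    then show "g x + g y \<le> g (x + y)" by (simp add: algebra_simps)
  qed
  have g_scale_le: "c *\<^sub>R g x \<le> g (c *\<^sub>R x)" if c: "0 < c" and x: "0 \<le> x" for c x
  proof -
    have "d \<le> inverse c *\<^sub>R g (c *\<^sub>R x)" if "(x, d) \<in> rk_sums G" for d
    proof -
      have "c *\<^sub>R d \<le> g (c *\<^sub>R x)"
        using c that lin by (intro le_g rk_sums_scale) auto
      from scaleR_left_mono[OF this, of "inverse c"] c show ?thesis by simp
    qed
    then have "g x \<le> inverse c *\<^sub>R g (c *\<^sub>R x)" by (rule g_le[OF x])
    from scaleR_left_mono[OF this, of c] c show ?thesis by simp
  qed
  have g_scale: "g (c *\<^sub>R x) = c *\<^sub>R g x" if c: "0 < c" and x: "0 \<le> x" for c x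
  proof (rule antisym)
    have "0 \<le> c *\<^sub>R x" using c x by (simp add: scaleR_nonneg_nonneg)
    from g_scale_le[OF _ this, of "inverse c"] c have "inverse c *\<^sub>R g (c *\<^sub>R x) \<le> g x" by simp
    from scaleR_left_mono[OF this, of c] c show "g (c *\<^sub>R x) \<le> c *\<^sub>R g x" by simp
  qed (rule g_scale_le[OF c x])
  obtain f where f: "linear f" "\<And>x. 0 \<le> x \<Longrightarrow> f x = g x"
    using linear_extension_from_cone[of g] g_add g_scale by metis
  have fupper: "T x \<le> f x" if "T \<in> G" "0 \<le> x" for T x
    using le_g[OF rk_sums_single[OF that]] f(2)[OF that(2)] by simp
  obtain T where T: "T \<in> G" using ne by (auto simp: G_def)
  have "positive_operator (\<lambda>x. f x - T x)"
    using fupper[OF T] f(1) lin[OF T] by (auto simp: positive_operator_def linear_compose_sub)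
  moreover have "regular_operator T" using T app_regop by (auto simp: G_def)
  ultimately have "regular_operator (\<lambda>x. (f x - T x) + T x)"
    by (rule regular_operator_add[OF positive_imp_regular])
  then have "regular_operator f" by simp
  then have app: "app_regop (Abs_regop f) = f" by (simp add: Abs_regop_inverse)
  have "\<forall>T\<in>F. T \<le> Abs_regop f"
    using fupper by (auto simp: less_eq_regop.rep_eq app G_def)
  moreover have "Abs_regop f \<le> V" if "\<forall>T\<in>F. T \<le> V" for V
    using bound[OF that] by (auto simp: less_eq_regop.rep_eq app f(2) intro!: g_le)
  ultimately show ?thesis by blast
qed

lemma regop_pair_bounded: "bdd_above {A, B :: 'a::dedekind_complete_vector_lattice regop}"
proof -
  have *: "\<exists>P. 0 \<le> P \<and> A \<le> P" for A :: "'a regop"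
  proof -
    obtain P Q where P: "positive_operator P" and Q: "positive_operator Q"
      and eq: "app_regop A = (\<lambda>x. P x - Q x)"
      using app_regop[of A] by (auto simp: regular_operator_def)
    have "app_regop (Abs_regop P) = P" using P by (simp add: Abs_regop_inverse positive_imp_regular)
    then have "0 \<le> Abs_regop P \<and> A \<le> Abs_regop P"
      using P Q by (simp add: less_eq_regop.rep_eq zero_regop.rep_eq eq positive_operator_def)
    then show ?thesis by blast
  qed
  obtain P Q where "0 \<le> P" "A \<le> P" "0 \<le> Q" "B \<le> Q" using *[of A] *[of B] by blast
  then have "A \<le> P + Q" "B \<le> P + Q" by (simp_all add: add_increasing2 add_increasing)
  then show ?thesis by (auto intro!: bdd_aboveI)
qed

instantiation regop :: (dedekind_complete_vector_lattice) dedekind_complete_vector_lattice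
begin

definition Sup_regop :: "'a regop set \<Rightarrow> 'a regop" where
  "Sup_regop F = (LEAST S. \<forall>T\<in>F. T \<le> S)"
definition Inf_regop :: "'a regop set \<Rightarrow> 'a regop" where
  "Inf_regop F = - Sup (uminus ` F)"
definition sup_regop :: "'a regop \<Rightarrow> 'a regop \<Rightarrow> 'a regop" where
  "sup_regop A B = Sup {A, B}"
definition inf_regop :: "'a regop \<Rightarrow> 'a regop \<Rightarrow> 'a regop" where
  "inf_regop A B = - sup (- A) (- B)"

instance
proof
  have Sup: "(\<forall>T\<in>F. T \<le> Sup F) \<and> (\<forall>V. (\<forall>T\<in>F. T \<le> V) \<longrightarrow> Sup F \<le> V)"
    if F: "F \<noteq> {}" "bdd_above F" for F :: "'a regop set"
  proof -
    obtain S where S: "\<forall>T\<in>F. T \<le> S" "\<forall>V. (\<forall>T\<in>F. T \<le> V) \<longrightarrow> S \<le> V"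
      using regop_has_Sup[OF F] by blast
    then have "Sup F = S" unfolding Sup_regop_def by (intro Least_equality) auto
    with S show ?thesis by simp
  qed
  fix A B C :: "'a regop" and F :: "'a regop set"
  note pair = Sup[OF _ regop_pair_bounded, folded sup_regop_def]
  have s1: "A \<le> sup A B" "B \<le> sup A B" for A B :: "'a regop" using pair[of A B] by auto
  have s2: "A \<le> C \<Longrightarrow> B \<le> C \<Longrightarrow> sup A B \<le> C" for A B C :: "'a regop" using pair[of A B] by auto
  show "A \<le> sup A B" "B \<le> sup A B" by (rule s1)+
  show "B \<le> A \<Longrightarrow> C \<le> A \<Longrightarrow> sup B C \<le> A" by (rule s2)
  show "inf A B \<le> A" "inf A B \<le> B"
    using s1(1)[of "- A" "- B"] s1(2)[of "- B" "- A"]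
    by (simp_all add: inf_regop_def minus_le_iff)
  show "A \<le> B \<Longrightarrow> A \<le> C \<Longrightarrow> A \<le> inf B C"
    using s2[of "- B" "- A" "- C"] by (simp add: inf_regop_def le_minus_iff)
  show "A \<in> F \<Longrightarrow> bdd_above F \<Longrightarrow> A \<le> Sup F" using Sup[of F] by auto
  show "F \<noteq> {} \<Longrightarrow> (\<And>x. x \<in> F \<Longrightarrow> x \<le> A) \<Longrightarrow> Sup F \<le> A"
    using Sup[of F] by (auto simp: bdd_above_def)
  show "A \<in> F \<Longrightarrow> bdd_below F \<Longrightarrow> Inf F \<le> A"
    using Sup[of "uminus ` F"] by (auto simp: Inf_regop_def minus_le_iff)
  show "A \<le> Inf F" if "F \<noteq> {}" "\<And>x. x \<in> F \<Longrightarrow> A \<le> x"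
  proof -
    have "bdd_above (uminus ` F)" using that(2) by (intro bdd_aboveI2[of _ _ "- A"]) simp
    with that Sup[of "uminus ` F"] have "Sup (uminus ` F) \<le> - A" by auto
    then have "- (- A) \<le> Inf F" unfolding Inf_regop_def by (rule le_imp_neg_le)
    then show ?thesis by simp
  qed
qed

end

section \<open>Regular operators on the complexification and the centre\<close>

text \<open>Elements of the type \<open>'a regop complexification\<close> are the regular operators \<open>A + i B\<close> on the
  complexification; they act by \<open>(A + i B)(x + i y) = (A x - B y) + i (A y + B x)\<close>.\<close>

definition app_c ::
  "'a::dedekind_complete_vector_lattice regop complexification \<Rightarrow> 'a complexification \<Rightarrow> 'a complexification"
where
  "app_c T z = Complexify
     (app_regop (re_part T) (re_part z) - app_regop (im_part T) (im_part z))
     (app_regop (re_part T) (im_part z) + app_regop (im_part T) (re_part z))"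

definition centre :: "'a::dedekind_complete_vector_lattice regop complexification set" where
  "centre = {T. \<exists>c\<ge>0. modulus T \<le> c *\<^sub>R id_regop}"

end

theory Submission
  imports Defs
begin

text \<open>With \<open>S = A + i B\<close>, \<open>T = C + i D\<close>, \<open>P X = A X - X C\<close> and \<open>Q X = B X - X D\<close>, statement (1) says
  \<open>P \<Xi> = - i Q \<Xi>\<close>, and it suffices to show \<open>P \<Xi> = 0\<close>. For central \<open>A\<close> the operator \<open>I + i t A\<close>
  increases the modulus at most by a factor \<open>1 + O(t\<^sup>2)\<close>, so the same holds for the action of
  \<open>I + i t P\<close> and \<open>I + i t Q\<close> on bounded operators. On the space \<open>P X = - i Q X\<close> this controls
  \<open>I + \<zeta> P\<close> for every complex \<open>\<zeta>\<close>, and a discrete form of Liouville's theorem for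
  \<open>(I + \<zeta> P)\<^sup>n\<close> yields \<open>P = 0\<close> there. The same argument applied to \<open>X \<mapsto> A X - X A\<close>, where
  positivity of \<open>I + s A\<close> handles the real direction, shows that the centre is commutative,
  which is needed for \<open>P\<close> and \<open>Q\<close> to commute.\<close>

section \<open>The complexification as a complex vector space\<close>

interpretation scaleC: vector_space "scaleC :: complex \<Rightarrow> 'a::real_vector complexification \<Rightarrow> _"
  by (rule vector_space_scaleC)

abbreviation clinear :: "('a::real_vector complexification \<Rightarrow> 'b::real_vector complexification) \<Rightarrow> bool" where
  "clinear \<equiv> Vector_Spaces.linear scaleC scaleC"

lemma clinear_iff:
  "clinear X \<longleftrightarrow> (\<forall>y z. X (y + z) = X y + X z) \<and> (\<forall>c z. X (scaleC c z) = scaleC c (X z))"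
  by (simp add: Vector_Spaces.linear_iff vector_space_scaleC)

lemma clinear_diff:
  assumes "clinear X"
  shows "X (y - z) = X y - X z"
  using assms unfolding clinear_iff by (metis add_diff_cancel diff_add_cancel)

lemma clinear_uminus:
  assumes "clinear X"
  shows "X (- z) = - X z"
  using clinear_diff[OF assms, of "z - z" z] clinear_diff[OF assms, of z z] by simp

lemmas clinear_simps = clinear_iff[THEN iffD1, THEN conjunct1, rule_format]
  clinear_iff[THEN iffD1, THEN conjunct2, rule_format] clinear_diff clinear_uminus

lemmas scaleC_simps = scaleC.scale_right_distrib scaleC.scale_left_distrib
  scaleC.scale_right_diff_distrib scaleC.scale_left_diff_distrib

lemma re_im_part_simps [simp]:
  "re_part (0 :: 'a::ab_group_add complexification) = 0" "im_part (0 :: 'a complexification) = 0"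
  "re_part (y + z) = re_part y + re_part z" "im_part (y + z) = im_part y + im_part z"
  "re_part (y - z) = re_part y - re_part z" "im_part (y - z) = im_part y - im_part z"
  "re_part (- z) = - re_part z" "im_part (- z) = - im_part z"
  by (simp_all add: zero_complexification_def plus_complexification_def
      minus_complexification_def uminus_complexification_def)

lemma re_im_part_scaleC [simp]:
  "re_part (scaleC c z) = Re c *\<^sub>R re_part z - Im c *\<^sub>R im_part z"
  "im_part (scaleC c z) = Re c *\<^sub>R im_part z + Im c *\<^sub>R re_part z"
  by (simp_all add: scaleC_def)

section \<open>The modulus\<close>

lemma modulus_least:
  assumes "\<And>\<theta>. cos \<theta> *\<^sub>R re_part z + sin \<theta> *\<^sub>R im_part z \<le> m"
  shows "modulus z \<le> m"
  unfolding modulus_def by (rule cSUP_least) (use assms in auto)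

text \<open>Polar coordinates write \<open>(a, b)\<close> as \<open>r\<close> times a unit vector,
  so the combination is \<open>r\<close> times a member of the family defining the modulus. Unit
  vectors then give the bound for every angle.\<close>

lemma real_combination_le_modulus:
  "a *\<^sub>R re_part z + b *\<^sub>R im_part z \<le> sqrt (a\<^sup>2 + b\<^sup>2) *\<^sub>R modulus z"
proof (cases "a = 0 \<and> b = 0")
  case False
  define r where "r = sqrt (a\<^sup>2 + b\<^sup>2)"
  have r: "r > 0" "r\<^sup>2 = a\<^sup>2 + b\<^sup>2"
    using False by (auto simp: r_def add_nonneg_pos add_pos_nonneg sum_power2_gt_zero_iff)
  then have "(a / r)\<^sup>2 + (b / r)\<^sup>2 = 1"
    using False by (simp add: power_divide flip: add_divide_distrib)
  then obtain \<theta> where \<theta>: "0 \<le> \<theta>" "\<theta> < 2 * pi" "a / r = cos \<theta>" "b / r = sin \<theta>"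
    using sincos_total_2pi by metis
  then have ab: "a = r * cos \<theta>" "b = r * sin \<theta>" using r(1) by (auto simp: field_simps)
  have "cos \<theta> *\<^sub>R re_part z + sin \<theta> *\<^sub>R im_part z \<le> modulus z"
    unfolding modulus_def using \<theta> by (intro cSUP_upper modulus_bdd_above) auto
  from scaleR_left_mono[OF this, of r] r(1)
  have "(r * cos \<theta>) *\<^sub>R re_part z + (r * sin \<theta>) *\<^sub>R im_part z \<le> r *\<^sub>R modulus z"
    by (simp add: scaleR_add_right)
  then show ?thesis by (simp only: ab[symmetric] r_def[symmetric])
qed auto

lemma cos_sin_le_modulus: "cos \<theta> *\<^sub>R re_part z + sin \<theta> *\<^sub>R im_part z \<le> modulus z"
  using real_combination_le_modulus[of "cos \<theta>" z "sin \<theta>"] by simp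

lemma parts_le_modulus:
  "re_part z \<le> modulus z" "- re_part z \<le> modulus z"
  "im_part z \<le> modulus z" "- im_part z \<le> modulus z"
  using real_combination_le_modulus[of 1 z 0] real_combination_le_modulus[of "-1" z 0]
    real_combination_le_modulus[of 0 z 1] real_combination_le_modulus[of 0 z "-1"] by simp_all

lemma modulus_nonneg: "0 \<le> modulus z"
proof -
  have "re_part z + - re_part z \<le> modulus z + modulus z"
    by (intro add_mono parts_le_modulus)
  then show ?thesis by simp
qed

lemma modulus_triangle: "modulus (y + z) \<le> modulus y + modulus z"
proof (rule modulus_least)
  fix \<theta>
  show "cos \<theta> *\<^sub>R re_part (y + z) + sin \<theta> *\<^sub>R im_part (y + z) \<le> modulus y + modulus z"
    using add_mono[OF cos_sin_le_modulus[of \<theta> y] cos_sin_le_modulus[of \<theta> z]]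
    by (simp add: algebra_simps)
qed

lemma modulus_scaleC_le: "modulus (scaleC c z) \<le> cmod c *\<^sub>R modulus z"
proof (rule modulus_least)
  fix \<theta>
  \<comment> \<open>As complex numbers, \<open>?a + i ?b = exp (i \<theta>) * cnj c\<close>, hence
    the length \<open>cmod c\<close>.\<close>
  let ?a = "cos \<theta> * Re c + sin \<theta> * Im c" and ?b = "sin \<theta> * Re c - cos \<theta> * Im c"
  have "?a\<^sup>2 + ?b\<^sup>2 = ((sin \<theta>)\<^sup>2 + (cos \<theta>)\<^sup>2) * ((Re c)\<^sup>2 + (Im c)\<^sup>2)"
    by (simp only: power2_eq_square) algebra
  then have "sqrt (?a\<^sup>2 + ?b\<^sup>2) = cmod c" by (simp add: cmod_def)
  then show "cos \<theta> *\<^sub>R re_part (scaleC c z) + sin \<theta> *\<^sub>R im_part (scaleC c z) \<le> cmod c *\<^sub>R modulus z"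
    using real_combination_le_modulus[of ?a z ?b] by (simp add: algebra_simps)
qed

lemma modulus_eq_0_imp:
  assumes "modulus z = 0"
  shows "z = 0"
  using parts_le_modulus[of z] assms
  by (intro complexification.expand) (auto intro!: order.antisym)

section \<open>The norm on the complexification\<close>

lemma sup_uminus_nonneg:
  fixes x :: "'a::dedekind_complete_vector_lattice"
  assumes "0 \<le> x"
  shows "sup x (- x) = x"
  using assms by (intro sup_absorb1) (meson neg_le_0_iff_le order_trans)

lemma norm_c_mono:
  assumes "modulus y \<le> k *\<^sub>R modulus z" "0 \<le> k"
  shows "norm_c y \<le> k * norm_c z"
proof -
  have "norm (modulus y) \<le> norm (k *\<^sub>R modulus z)"
    using assms by (intro norm_lattice_mono) (simp add: sup_uminus_nonneg modulus_nonneg scaleR_nonneg_nonneg)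
  then show ?thesis using assms(2) by (simp add: norm_c_def)
qed

lemma norm_c_nonneg: "0 \<le> norm_c z"
  by (simp add: norm_c_def)

lemma norm_c_eq_0_imp: "norm_c z = 0 \<Longrightarrow> z = 0"
  by (auto simp: norm_c_def intro: modulus_eq_0_imp)

lemma norm_c_triangle: "norm_c (y + z) \<le> norm_c y + norm_c z"
proof -
  have "norm (modulus (y + z)) \<le> norm (modulus y + modulus z)"
    by (intro norm_lattice_mono) (simp only: sup_uminus_nonneg add_nonneg_nonneg modulus_nonneg modulus_triangle)
  also have "\<dots> \<le> norm (modulus y) + norm (modulus z)" by (rule norm_triangle_ineq)
  finally show ?thesis by (simp add: norm_c_def)
qed

lemma norm_c_scaleC_le: "norm_c (scaleC c z) \<le> cmod c * norm_c z"
  by (intro norm_c_mono modulus_scaleC_le) simp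

lemma norm_c_scaleC:
  "norm_c (scaleC c z) = cmod c * norm_c z"
proof (cases "c = 0")
  case True
  then show ?thesis using norm_c_scaleC_le[of c z] norm_c_nonneg[of "scaleC c z"] by simp
next
  case False
  have "cmod c * norm_c z \<le> cmod c * (cmod (inverse c) * norm_c (scaleC c z))"
    using norm_c_scaleC_le[of "inverse c" "scaleC c z"] False by (intro mult_left_mono) auto
  also have "\<dots> = norm_c (scaleC c z)" using False by (simp add: norm_inverse)
  finally show ?thesis using norm_c_scaleC_le[of c z] by simp
qed

lemma norm_c_sum_le:
  fixes f :: "nat \<Rightarrow> 'a::dedekind_complete_banach_lattice complexification"
  shows "norm_c (\<Sum>k<m. f k) \<le> (\<Sum>k<m. norm_c (f k))"
proof (induction m)
  case 0
  then show ?case using norm_c_scaleC[of 0 "0 :: 'a complexification"] by simp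
next
  case (Suc m)
  then show ?case using norm_c_triangle[of "\<Sum>k<m. f k" "f m"] by simp
qed

section \<open>A Cauchy estimate for vector-valued polynomials\<close>

lemma sum_powers_root_of_unity:
  fixes q :: complex
  assumes "q ^ m = 1" "q \<noteq> 1"
  shows "(\<Sum>k<m. q ^ k) = 0"
  using assms by (simp add: geometric_sum)

text \<open>Averaging over the \<open>(n + 1)\<close>-st roots of unity isolates the linear coefficient.\<close>

lemma cauchy_estimate_linear_coefficient:
  fixes y :: "nat \<Rightarrow> 'a::dedekind_complete_banach_lattice complexification"
  assumes r: "0 \<le> r" and n: "1 \<le> n"
    and bound: "\<And>\<zeta>. cmod \<zeta> = r \<Longrightarrow> norm_c (\<Sum>j\<le>n. scaleC (\<zeta> ^ j) (y j)) \<le> b"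
  shows "r * norm_c (y 1) \<le> b"
proof -
  define m where "m = Suc n"
  define \<omega> where "\<omega> = exp (2 * of_real pi * \<i> * of_nat 1 / of_nat m)"
  have \<omega>: "cmod \<omega> = 1" by (simp add: \<omega>_def)
  have \<omega>_pow: "\<omega> ^ j = 1 \<longleftrightarrow> m dvd j" for j
  proof -
    have "\<omega> ^ j = exp (2 * of_real pi * \<i> * of_nat j / of_nat m)"
      unfolding \<omega>_def exp_of_nat_mult[symmetric] by (simp add: field_simps)
    then show ?thesis using complex_root_unity_eq_1[of m j] by (simp add: m_def)
  qed
  \<comment> \<open>Since \<open>n\<close> is -1 modulo \<open>m\<close>, the weight
    \<open>\<omega> ^ (k * n)\<close> below acts as the inverse of \<open>\<omega> ^ k\<close> and
    singles out \<open>j = 1\<close>: the only multiple of \<open>m\<close> strictly between 0 and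
    \<open>2 m\<close> is \<open>m\<close>.\<close>
  have dvd: "m dvd j + n \<longleftrightarrow> j = 1" if "j \<le> n" for j
  proof
    assume "m dvd j + n"
    then obtain k where "j + n = m * k" by blast
    moreover have "k < 2"
    proof (rule ccontr)
      assume "\<not> k < 2"
      then have "m * 2 \<le> m * k" by (intro mult_le_mono2) simp
      then show False using \<open>j + n = m * k\<close> that by (simp add: m_def)
    qed
    ultimately have "k = 1" using n by (cases k) auto
    then show "j = 1" using \<open>j + n = m * k\<close> by (simp add: m_def)
  qed (simp add: m_def)
  have filter: "(\<Sum>k<m. \<omega> ^ (k * n) * (r * \<omega> ^ k) ^ j) = (if j = 1 then of_nat m * r else 0)"
    if "j \<le> n" for j
  proof -
    have "(\<Sum>k<m. \<omega> ^ (k * n) * (r * \<omega> ^ k) ^ j) = r ^ j * (\<Sum>k<m. (\<omega> ^ (j + n)) ^ k)"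
      by (simp add: sum_distrib_left power_mult_distrib power_add mult_ac flip: power_mult)
    moreover have "(\<Sum>k<m. (\<omega> ^ (j + n)) ^ k) = 0" if "j \<noteq> 1"
    proof (rule sum_powers_root_of_unity)
      show "(\<omega> ^ (j + n)) ^ m = 1" unfolding power_mult[symmetric] \<omega>_pow by simp
      show "\<omega> ^ (j + n) \<noteq> 1" using dvd[OF \<open>j \<le> n\<close>] that by (simp add: \<omega>_pow)
    qed
    moreover have "\<omega> ^ (1 + n) = 1" by (simp only: \<omega>_pow m_def) simp
    ultimately show ?thesis by auto
  qed
  have "(\<Sum>k<m. scaleC (\<omega> ^ (k * n)) (\<Sum>j\<le>n. scaleC ((r * \<omega> ^ k) ^ j) (y j)))
      = (\<Sum>j\<le>n. \<Sum>k<m. scaleC (\<omega> ^ (k * n) * (r * \<omega> ^ k) ^ j) (y j))"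
    unfolding scaleC.scale_sum_right scaleC.scale_scale by (rule sum.swap)
  also have "\<dots> = (\<Sum>j\<le>n. if j = 1 then scaleC (of_nat m * r) (y 1) else 0)"
    by (intro sum.cong) (auto simp: filter simp flip: scaleC.scale_sum_left)
  also have "\<dots> = scaleC (of_nat m * r) (y 1)" using n by simp
  finally have eq: "scaleC (of_nat m * r) (y 1)
      = (\<Sum>k<m. scaleC (\<omega> ^ (k * n)) (\<Sum>j\<le>n. scaleC ((r * \<omega> ^ k) ^ j) (y j)))" ..
  have "norm_c (scaleC (of_nat m * r) (y 1))
      \<le> (\<Sum>k<m. norm_c (scaleC (\<omega> ^ (k * n)) (\<Sum>j\<le>n. scaleC ((r * \<omega> ^ k) ^ j) (y j))))"
    unfolding eq by (rule norm_c_sum_le)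
  also have "\<dots> \<le> (\<Sum>k<m. b)"
    using r by (intro sum_mono)
      (simp add: norm_c_scaleC norm_power \<omega>, rule bound, simp add: norm_mult norm_power \<omega>)
  finally have "m * (r * norm_c (y 1)) \<le> m * b"
    using r by (simp add: norm_c_scaleC norm_mult mult_ac)
  then show ?thesis by (simp add: m_def)
qed

section \<open>Central operators\<close>

definition lift_op :: "('a::ab_group_add \<Rightarrow> 'a) \<Rightarrow> 'a complexification \<Rightarrow> 'a complexification" where
  "lift_op P z = Complexify (P (re_part z)) (P (im_part z))"

lemma lift_op_parts [simp]:
  "re_part (lift_op P z) = P (re_part z)" "im_part (lift_op P z) = P (im_part z)"
  by (simp_all add: lift_op_def)

text \<open>Each member of the family for \<open>lift_op P z\<close> is \<open>P\<close> of a member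
  of the family for \<open>z\<close>, and \<open>P\<close> preserves the order.\<close>

lemma modulus_lift_op_le:
  assumes "positive_operator P"
  shows "modulus (lift_op P z) \<le> P (modulus z)"
proof (rule modulus_least)
  fix \<theta>
  have lin: "linear P" and pos: "\<And>x. 0 \<le> x \<Longrightarrow> 0 \<le> P x"
    using assms by (auto simp: positive_operator_def)
  have "0 \<le> P (modulus z - (cos \<theta> *\<^sub>R re_part z + sin \<theta> *\<^sub>R im_part z))"
    by (intro pos) (simp add: cos_sin_le_modulus)
  then show "cos \<theta> *\<^sub>R re_part (lift_op P z) + sin \<theta> *\<^sub>R im_part (lift_op P z) \<le> P (modulus z)"
    by (simp add: linear_diff[OF lin] linear_add[OF lin] linear_scale[OF lin])
qed

lemma positive_operator_mono:
  assumes "positive_operator P" "x \<le> y"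
  shows "P x \<le> P y"
proof -
  have "0 \<le> P (y - x)" using assms by (simp add: positive_operator_def)
  then show ?thesis using assms(1) by (simp add: positive_operator_def linear_diff)
qed

text \<open>Encodes |A| \<le> c I by two one-sided bounds, which can be tested on the positive cone
  without computing a supremum of operators.\<close>

definition centrally_bounded :: "real \<Rightarrow> 'a::dedekind_complete_vector_lattice regop \<Rightarrow> bool" where
  "centrally_bounded c A \<longleftrightarrow> A \<le> c *\<^sub>R id_regop \<and> - A \<le> c *\<^sub>R id_regop"

abbreviation central_op ::
  "'a::dedekind_complete_vector_lattice regop \<Rightarrow> 'a complexification \<Rightarrow> 'a complexification" where
  "central_op A \<equiv> lift_op (app_regop A)"

lemma linear_app_regop: "linear (app_regop A)"
  using app_regop[of A] by (simp add: regular_operator_linear)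

lemmas app_regop_simps = linear_add[OF linear_app_regop] linear_diff[OF linear_app_regop]
  linear_scale[OF linear_app_regop] linear_0[OF linear_app_regop] linear_neg[OF linear_app_regop]

lemma clinear_central_op: "clinear (central_op A)"
  unfolding clinear_iff
  by (auto intro!: complexification.expand simp: app_regop_simps)

lemma centrally_bounded_apply:
  assumes "centrally_bounded c A" "0 \<le> x"
  shows "app_regop A x \<le> c *\<^sub>R x" "- app_regop A x \<le> c *\<^sub>R x"
  using assms by (auto simp: centrally_bounded_def less_eq_regop.rep_eq scaleR_regop.rep_eq
      id_regop.rep_eq uminus_regop.rep_eq)

text \<open>On the cone \<open>- s A x\<close> is at most \<open>|s| c x\<close>, hence at most
  \<open>x\<close>; the sign of \<open>s\<close> decides which one-sided bound is used.\<close>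

lemma positive_operator_ident_plus_central:
  assumes "centrally_bounded c A" "\<bar>s\<bar> * c \<le> 1"
  shows "positive_operator (\<lambda>x. x + s *\<^sub>R app_regop A x)"
  unfolding positive_operator_def
proof (intro conjI allI impI)
  show "linear (\<lambda>x. x + s *\<^sub>R app_regop A x)"
    by (intro linear_compose_add linear_ident linear_compose_scale_right linear_app_regop)
  fix x :: 'a
  assume x: "0 \<le> x"
  have "- (s *\<^sub>R app_regop A x) \<le> \<bar>s\<bar> *\<^sub>R (c *\<^sub>R x)"
  proof (cases "0 \<le> s")
    case True
    then show ?thesis
      using scaleR_left_mono[OF centrally_bounded_apply(2)[OF assms(1) x], of s] by simp
  next
    case False
    then show ?thesis
      using scaleR_left_mono[OF centrally_bounded_apply(1)[OF assms(1) x], of "- s"] by simp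
  qed
  also have "\<dots> \<le> 1 *\<^sub>R x"
    using scaleR_right_mono[OF assms(2) x] by simp
  finally have "- (s *\<^sub>R app_regop A x) + s *\<^sub>R app_regop A x \<le> x + s *\<^sub>R app_regop A x"
    by (intro add_right_mono) simp
  then show "0 \<le> x + s *\<^sub>R app_regop A x" by simp
qed

text \<open>With \<open>P = (I + A/c)/2\<close> and \<open>Q = (I - A/c)/2\<close>, which are positive and sum to \<open>I\<close>, one has
  \<open>a + b A = (a + b c) P + (a - b c) Q\<close>.\<close>

lemma modulus_affine_central_le:
  fixes a b :: complex
  assumes c: "0 < c" and A: "centrally_bounded c A"
    and k: "cmod (a + b * c) \<le> k" "cmod (a - b * c) \<le> k"
  shows "modulus (scaleC a z + scaleC b (central_op A z)) \<le> k *\<^sub>R modulus z"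
proof -
  define P where "P s x = (1/2) *\<^sub>R (x + (s / c) *\<^sub>R app_regop A x)" for s :: real and x
  have P: "positive_operator (P s)" if "\<bar>s\<bar> = 1" for s
    unfolding P_def using c that
    by (intro positive_operator_scale positive_operator_ident_plus_central[OF A]) auto
  have le: "modulus (lift_op (P s) (scaleC d z)) \<le> P s (k *\<^sub>R modulus z)"
    if "\<bar>s\<bar> = 1" "cmod d \<le> k" for s d
  proof -
    have "modulus (scaleC d z) \<le> k *\<^sub>R modulus z"
      using modulus_scaleC_le[of d z] scaleR_right_mono[OF that(2) modulus_nonneg[of z]] by simp
    then show ?thesis
      using modulus_lift_op_le[OF P, of s "scaleC d z"] positive_operator_mono[OF P] that
      by (meson order_trans)
  qed
  \<comment> \<open>Used twice: on the parts of \<open>u\<close> and \<open>v\<close> it splits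
    \<open>a + b A\<close>, and with \<open>y = 0\<close> it says that the two positive operators
    sum to the identity.\<close>
  have P_eq: "P 1 (x + y) + P (- 1) (x - y) = x + (1 / c) *\<^sub>R app_regop A y" for x y
  proof -
    have "P 1 (x + y) + P (- 1) (x - y)
        = (1/2) *\<^sub>R ((x + y + (1 / c) *\<^sub>R app_regop A (x + y))
          + (x - y + (- 1 / c) *\<^sub>R app_regop A (x - y)))"
      unfolding P_def scaleR_add_right[symmetric] ..
    also have "\<dots> = (1/2) *\<^sub>R (2 *\<^sub>R (x + (1 / c) *\<^sub>R app_regop A y))"
      unfolding scaleR_2 by (rule arg_cong) (simp add: app_regop_simps scaleR_add_right scaleR_diff_right)
    finally show ?thesis by simp
  qed
  define u v where "u = scaleC a z" and "v = scaleC (b * c) z"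
  have "scaleC b (central_op A z) = lift_op (\<lambda>x. (1 / c) *\<^sub>R app_regop A x) v"
    using c
    by (intro complexification.expand conjI)
      (simp_all add: v_def app_regop_simps scaleR_diff_right scaleR_add_right)
  then have "scaleC a z + scaleC b (central_op A z) = lift_op (P 1) (u + v) + lift_op (P (- 1)) (u - v)"
    by (intro complexification.expand conjI) (simp_all add: P_eq u_def)
  then have eq: "scaleC a z + scaleC b (central_op A z)
      = lift_op (P 1) (scaleC (a + b * c) z) + lift_op (P (- 1)) (scaleC (a - b * c) z)"
    by (simp add: u_def v_def scaleC_simps)
  have "modulus (scaleC a z + scaleC b (central_op A z))
      \<le> P 1 (k *\<^sub>R modulus z) + P (- 1) (k *\<^sub>R modulus z)"
    unfolding eq by (rule order_trans[OF modulus_triangle add_mono]; intro le) (use k in auto)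
  also have "\<dots> = k *\<^sub>R modulus z"
    using P_eq[of "k *\<^sub>R modulus z" 0] by (simp add: app_regop_simps)
  finally show ?thesis .
qed

lemma modulus_central_op_le:
  assumes "0 < c" "centrally_bounded c A"
  shows "modulus (central_op A z) \<le> c *\<^sub>R modulus z"
  using modulus_affine_central_le[OF assms, where a = 0 and b = 1 and k = c and z = z] assms(1) by simp

text \<open>For \<open>b = i t\<close> both \<open>1 + b c\<close> and \<open>1 - b c\<close> have
  modulus \<open>sqrt (1 + t^2 c^2)\<close>, which has no linear term in \<open>t\<close>.\<close>

lemma modulus_ident_plus_imaginary_central_le:
  assumes "0 < c" "centrally_bounded c A"
  shows "modulus (z + scaleC (\<i> * of_real t) (central_op A z)) \<le> (1 + c\<^sup>2 * t\<^sup>2) *\<^sub>R modulus z"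
proof -
  have "sqrt (1 + (t * c)\<^sup>2) \<le> 1 + c\<^sup>2 * t\<^sup>2"
  proof (rule real_le_lsqrt)
    have "1 + (t * c)\<^sup>2 \<le> 1 + (t * c)\<^sup>2 + ((t * c)\<^sup>2 + (c\<^sup>2 * t\<^sup>2)\<^sup>2)" by simp
    also have "\<dots> = (1 + c\<^sup>2 * t\<^sup>2)\<^sup>2" by (simp add: power2_eq_square algebra_simps)
    finally show "1 + (t * c)\<^sup>2 \<le> (1 + c\<^sup>2 * t\<^sup>2)\<^sup>2" .
  qed simp
  then show ?thesis
    using modulus_affine_central_le[OF assms,
        where a = 1 and b = "\<i> * of_real t" and k = "1 + c\<^sup>2 * t\<^sup>2" and z = z]
    by (simp add: cmod_def)
qed

section \<open>Operators with quadratically bounded perturbation of the identity\<close>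

text \<open>The generalized derivation induced by \<open>U\<close> and \<open>V\<close>; its zeros
  are the operators intertwining them.\<close>

definition intertwiner ::
  "('b \<Rightarrow> 'b) \<Rightarrow> ('a \<Rightarrow> 'a) \<Rightarrow> ('a \<Rightarrow> 'b::minus) \<Rightarrow> 'a \<Rightarrow> 'b" where
  "intertwiner U V X z = U (X z) - X (V z)"

lemma intertwiner_add_scaleC:
  assumes "clinear U"
  shows "intertwiner U V (\<lambda>z. X z + scaleC \<zeta> (Y z))
    = (\<lambda>z. intertwiner U V X z + scaleC \<zeta> (intertwiner U V Y z))"
  by (rule ext) (simp add: intertwiner_def clinear_simps[OF assms] scaleC_simps)

text \<open>Pascal's rule. With \<open>d j = D^j X z\<close> it describes one more factor
  \<open>I + \<zeta> D\<close> in the binomial expansion.\<close>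

lemma binomial_power_sum_Suc:
  fixes d :: "nat \<Rightarrow> 'a::real_vector complexification"
  shows "(\<Sum>j\<le>Suc n. scaleC (of_nat (Suc n choose j) * \<zeta> ^ j) (d j))
    = (\<Sum>j\<le>n. scaleC (of_nat (n choose j) * \<zeta> ^ j) (d j))
      + scaleC \<zeta> (\<Sum>j\<le>n. scaleC (of_nat (n choose j) * \<zeta> ^ j) (d (Suc j)))"
proof -
  have "(\<Sum>j\<le>Suc n. scaleC (of_nat (Suc n choose j) * \<zeta> ^ j) (d j))
      = d 0 + (\<Sum>j\<le>n. scaleC (of_nat (n choose Suc j) * \<zeta> ^ Suc j) (d (Suc j)))
        + (\<Sum>j\<le>n. scaleC (of_nat (n choose j) * \<zeta> ^ Suc j) (d (Suc j)))"
    unfolding sum.atMost_Suc_shift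
    by (simp add: scaleC.scale_left_distrib sum.distrib algebra_simps)
  also have "d 0 + (\<Sum>j\<le>n. scaleC (of_nat (n choose Suc j) * \<zeta> ^ Suc j) (d (Suc j)))
      = (\<Sum>j\<le>Suc n. scaleC (of_nat (n choose j) * \<zeta> ^ j) (d j))"
    unfolding sum.atMost_Suc_shift by simp
  \<comment> \<open>The top term drops since \<open>n choose Suc n = 0\<close>.\<close>
  also have "\<dots> = (\<Sum>j\<le>n. scaleC (of_nat (n choose j) * \<zeta> ^ j) (d j))" by simp
  finally show ?thesis
    by (simp add: scaleC.scale_sum_right mult_ac)
qed

text \<open>The two instances are \<^const>\<open>modulus\<close> and \<^const>\<open>norm_c\<close>.\<close>

locale gauge =
  fixes g :: "'a::dedekind_complete_banach_lattice complexification \<Rightarrow> 'e::ordered_real_vector"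
  assumes nonneg: "0 \<le> g z"
    and triangle: "g (y + z) \<le> g y + g z"
    and mono: "modulus y \<le> k *\<^sub>R modulus z \<Longrightarrow> 0 \<le> k \<Longrightarrow> g y \<le> k *\<^sub>R g z"
    and norm_c_le: "g y \<le> k *\<^sub>R g z \<Longrightarrow> 0 \<le> k \<Longrightarrow> norm_c y \<le> k * norm_c z"
begin

text \<open>For \<open>norm_c\<close> this is a bound on the operator norm; for
  \<open>modulus\<close> it is a pointwise lattice bound, to which positive operators can be
  applied.\<close>

definition dominated :: "real \<Rightarrow> ('a complexification \<Rightarrow> 'a complexification) \<Rightarrow> bool" where
  "dominated k X \<longleftrightarrow> 0 \<le> k \<and> (\<forall>z. g (X z) \<le> k *\<^sub>R g z)"

lemma dominated_weaken: "dominated k X \<Longrightarrow> k \<le> l \<Longrightarrow> dominated l X"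
  unfolding dominated_def by (meson nonneg order_trans scaleR_right_mono)

lemma dominated_add:
  assumes "dominated k X" "dominated l Y"
  shows "dominated (k + l) (\<lambda>z. X z + Y z)"
  unfolding dominated_def
proof (intro conjI allI)
  fix z
  have "g (X z + Y z) \<le> g (X z) + g (Y z)" by (rule triangle)
  also have "\<dots> \<le> k *\<^sub>R g z + l *\<^sub>R g z" using assms by (intro add_mono) (auto simp: dominated_def)
  finally show "g (X z + Y z) \<le> (k + l) *\<^sub>R g z" by (simp add: scaleR_left_distrib)
qed (use assms in \<open>auto simp: dominated_def\<close>)

lemma dominated_compose:
  assumes "dominated k X" "dominated l Y"
  shows "dominated (k * l) (\<lambda>z. X (Y z))"
  unfolding dominated_def
proof (intro conjI allI)
  fix z
  have "g (X (Y z)) \<le> k *\<^sub>R g (Y z)" using assms by (auto simp: dominated_def)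
  also have "\<dots> \<le> k *\<^sub>R (l *\<^sub>R g z)" using assms by (intro scaleR_left_mono) (auto simp: dominated_def)
  finally show "g (X (Y z)) \<le> (k * l) *\<^sub>R g z" by simp
qed (use assms in \<open>auto simp: dominated_def\<close>)

lemma dominated_mono:
  assumes "\<And>z. modulus (X z) \<le> k *\<^sub>R modulus z" "0 \<le> k"
  shows "dominated k X"
  using assms by (auto simp: dominated_def intro: mono)

lemma dominated_scaleC:
  assumes "dominated k X"
  shows "dominated (cmod c * k) (\<lambda>z. scaleC c (X z))"
  using dominated_compose[OF dominated_mono[OF modulus_scaleC_le, of c] assms] by simp

text \<open>The hypotheses say that on \<open>W\<close> both \<open>D\<close> and \<open>i D\<close> are Hermitian up to a quadratic error, so
  that \<open>(I + \<zeta> D)\<^sup>n\<close> has norm at most \<open>(1 + L |\<zeta>|\<^sup>2)\<^sup>n\<close>. Its linear coefficient is \<open>n D\<close>, and the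
  Cauchy estimate at radius \<open>1 / sqrt n\<close> bounds \<open>D\<close> by a multiple of \<open>1 / sqrt n\<close>.\<close>

lemma intertwiner_eq_0:
  fixes U V :: "'a complexification \<Rightarrow> 'a complexification"
  defines "D \<equiv> intertwiner U V"
  assumes U: "clinear U"
    and W_D: "\<And>X. X \<in> W \<Longrightarrow> D X \<in> W"
    and W_add: "\<And>X Y \<zeta>. X \<in> W \<Longrightarrow> Y \<in> W \<Longrightarrow> (\<lambda>z. X z + scaleC \<zeta> (Y z)) \<in> W"
    and \<epsilon>: "0 < \<epsilon>" "\<epsilon> \<le> 1" and K: "0 \<le> K"
    and real: "\<And>X k s. X \<in> W \<Longrightarrow> dominated k X \<Longrightarrow> \<bar>s\<bar> \<le> \<epsilon> \<Longrightarrow>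
      dominated ((1 + K * s\<^sup>2) * k) (\<lambda>z. X z + scaleC (of_real s) (D X z))"
    and imag: "\<And>X k s. X \<in> W \<Longrightarrow> dominated k X \<Longrightarrow> \<bar>s\<bar> \<le> \<epsilon> \<Longrightarrow>
      dominated ((1 + K * s\<^sup>2) * k) (\<lambda>z. X z + scaleC (\<i> * of_real s) (D X z))"
    and bounded: "\<And>X k. X \<in> W \<Longrightarrow> dominated k X \<Longrightarrow> dominated (M * k) (D X)"
    and X: "X \<in> W" "dominated k X"
  shows "D X z = 0"
proof -
  \<comment> \<open>\<open>K\<close> collects the errors of the real and imaginary factors in
    \<open>step\<close>, \<open>K^2\<close> their product, \<open>M^2\<close> the correction by
    \<open>D^2\<close>.\<close>
  define L where "L = K + K\<^sup>2 + M\<^sup>2"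
  define F where "F \<zeta> X z = X z + scaleC \<zeta> (D X z)" for \<zeta> X z
  have D_add: "D (\<lambda>z. X z + scaleC \<zeta> (Y z)) = (\<lambda>z. D X z + scaleC \<zeta> (D Y z))" for X Y \<zeta>
    unfolding D_def by (rule intertwiner_add_scaleC[OF U])
  have L: "0 \<le> L" using K by (simp add: L_def)
  have F_W: "F \<zeta> X \<in> W" if "X \<in> W" for \<zeta> X
    unfolding F_def[abs_def] using that by (intro W_add W_D)
  have step: "dominated ((1 + L * (cmod \<zeta>)\<^sup>2) * k) (F \<zeta> X)"
    if X: "X \<in> W" "dominated k X" and \<zeta>: "cmod \<zeta> \<le> \<epsilon>" for \<zeta> X k
  proof -
    define s t where "s = Re \<zeta>" and "t = Im \<zeta>"
    have st: "\<bar>s\<bar> \<le> \<epsilon>" "\<bar>t\<bar> \<le> \<epsilon>"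
      using abs_Re_le_cmod[of \<zeta>] abs_Im_le_cmod[of \<zeta>] \<zeta> by (auto simp: s_def t_def)
    have k: "0 \<le> k" using X by (simp add: dominated_def)
    \<comment> \<open>For \<open>\<zeta> = s + i t\<close> one has
      \<open>(I + s D) (I + i t D) = I + \<zeta> D + i s t D^2\<close>. The hypotheses
      \<open>real\<close> and \<open>imag\<close> bound the product; removing the last term costs at
      most \<open>|s t| M^2 k\<close>.\<close>
    define Y where "Y = F (\<i> * of_real t) X"
    have "dominated ((1 + K * s\<^sup>2) * ((1 + K * t\<^sup>2) * k)) (F (of_real s) Y)"
      unfolding Y_def F_def[abs_def]
      by (intro real imag X st F_W[unfolded F_def[abs_def]])
    then have "dominated ((1 + K * s\<^sup>2) * ((1 + K * t\<^sup>2) * k)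
          + cmod (- \<i> * of_real (s * t)) * (M * (M * k)))
        (\<lambda>z. F (of_real s) Y z + scaleC (- \<i> * of_real (s * t)) (D (D X) z))"
      by (rule dominated_add[OF _ dominated_scaleC[OF bounded[OF W_D[OF X(1)] bounded[OF X]]]])
    moreover have "(\<lambda>z. F (of_real s) Y z + scaleC (- \<i> * of_real (s * t)) (D (D X) z)) = F \<zeta> X"
    proof
      fix z
      have "F (of_real s) Y z = X z + scaleC (\<i> * of_real t) (D X z)
          + (scaleC (of_real s) (D X z) + scaleC (of_real s * (\<i> * of_real t)) (D (D X) z))"
        by (simp add: F_def[abs_def] Y_def D_add scaleC_simps)
      moreover have "scaleC \<zeta> (D X z) = scaleC (of_real s) (D X z) + scaleC (\<i> * of_real t) (D X z)"
        by (simp add: s_def t_def complex_eq flip: scaleC.scale_left_distrib)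
      ultimately show "F (of_real s) Y z + scaleC (- \<i> * of_real (s * t)) (D (D X) z) = F \<zeta> X z"
        by (simp add: F_def mult_ac)
    qed
    moreover have "(1 + K * s\<^sup>2) * ((1 + K * t\<^sup>2) * k) + cmod (- \<i> * of_real (s * t)) * (M * (M * k))
        \<le> (1 + L * (cmod \<zeta>)\<^sup>2) * k"
    proof -
      have z: "(cmod \<zeta>)\<^sup>2 = s\<^sup>2 + t\<^sup>2" by (simp add: cmod_power2 s_def t_def)
      \<comment> \<open>\<open>\<epsilon> \<le> 1\<close> reduces the quartic error
        \<open>K^2 s^2 t^2\<close> to a quadratic one.\<close>
      have "t\<^sup>2 \<le> 1" using st \<epsilon> by (simp add: abs_square_le_1)
      then have "K\<^sup>2 * (s\<^sup>2 * t\<^sup>2) \<le> K\<^sup>2 * (s\<^sup>2 + t\<^sup>2)"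
        by (intro mult_left_mono) (auto simp: mult_left_le add_increasing2)
      moreover have "\<bar>s * t\<bar> * M\<^sup>2 \<le> (s\<^sup>2 + t\<^sup>2) * M\<^sup>2"
      proof (rule mult_right_mono)
        have "2 * (\<bar>s\<bar> * \<bar>t\<bar>) \<le> s\<^sup>2 + t\<^sup>2" "0 \<le> \<bar>s\<bar> * \<bar>t\<bar>"
          using sum_squares_bound[of "\<bar>s\<bar>" "\<bar>t\<bar>"] by simp_all
        then show "\<bar>s * t\<bar> \<le> s\<^sup>2 + t\<^sup>2" unfolding abs_mult by linarith
      qed simp
      ultimately have "(1 + K * s\<^sup>2) * (1 + K * t\<^sup>2) + \<bar>s * t\<bar> * M\<^sup>2 \<le> 1 + L * (cmod \<zeta>)\<^sup>2"
        unfolding z L_def by (simp add: algebra_simps power2_eq_square)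
      from mult_right_mono[OF this k] show ?thesis
        by (simp add: norm_mult abs_mult algebra_simps power2_eq_square)
    qed
    ultimately show ?thesis using dominated_weaken by metis
  qed
  have iterate: "(F \<zeta> ^^ n) X \<in> W \<and> dominated ((1 + L * (cmod \<zeta>)\<^sup>2) ^ n * k) ((F \<zeta> ^^ n) X)"
    if "cmod \<zeta> \<le> \<epsilon>" for \<zeta> n
  proof (induction n)
    case (Suc n)
    then show ?case
      using step[of "(F \<zeta> ^^ n) X" _ \<zeta>] F_W that by (simp add: mult.assoc)
  qed (use X in simp)
  have D_sum: "D (\<lambda>z. \<Sum>j\<le>n. scaleC (c j) (Y j z)) z = (\<Sum>j\<le>n. scaleC (c j) (D (Y j) z))"
    for n z and c :: "nat \<Rightarrow> complex" and Y
  proof (induction n)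
    case 0
    show ?case by (simp add: D_def intertwiner_def clinear_simps[OF U] scaleC_simps)
  next
    case (Suc n)
    then show ?case by (simp add: D_add)
  qed
  have expand: "(F \<zeta> ^^ n) X = (\<lambda>z. \<Sum>j\<le>n. scaleC (of_nat (n choose j) * \<zeta> ^ j) ((D ^^ j) X z))"
    for \<zeta> n
  proof (induction n)
    case (Suc n)
    have "(F \<zeta> ^^ Suc n) X
        = F \<zeta> (\<lambda>z. \<Sum>j\<le>n. scaleC (of_nat (n choose j) * \<zeta> ^ j) ((D ^^ j) X z))"
      by (simp add: Suc.IH)
    then show ?case
      by (simp only: F_def[abs_def] D_sum binomial_power_sum_Suc) simp
  qed simp
  \<comment> \<open>Independent of \<open>n\<close>, because
    \<open>(1 + L / n)^n \<le> exp L\<close>.\<close>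
  define b where "b = exp L * k * norm_c z"
  have est: "sqrt n * norm_c (D X z) \<le> b" if n: "1 \<le> n" "1 / \<epsilon>\<^sup>2 \<le> n" for n :: nat
  proof -
    \<comment> \<open>\<open>1 / \<epsilon>^2 \<le> n\<close> gives
      \<open>r \<le> \<epsilon>\<close>, so \<open>iterate\<close> applies on the circle; the linear
      coefficient \<open>n D X z\<close> then carries the factor
      \<open>n r = sqrt n\<close>.\<close>
    define r where "r = 1 / sqrt n"
    have r: "0 < r" "r\<^sup>2 = 1 / n" "n * r = sqrt n"
      using n by (auto simp: r_def power_divide real_div_sqrt)
    have "r\<^sup>2 \<le> \<epsilon>\<^sup>2" using n \<epsilon> by (simp add: r field_simps)
    then have r_le: "r \<le> \<epsilon>" by (rule power2_le_imp_le) (use \<epsilon> in simp)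
    have "r * norm_c (scaleC (of_nat (n choose 1)) ((D ^^ 1) X z)) \<le> b"
    proof (rule cauchy_estimate_linear_coefficient[OF _ n(1)])
      fix \<zeta> assume \<zeta>: "cmod \<zeta> = r"
      have "dominated ((1 + L * r\<^sup>2) ^ n * k) ((F \<zeta> ^^ n) X)"
        using iterate[of \<zeta> n] \<zeta> r_le by simp
      then have "norm_c ((F \<zeta> ^^ n) X z) \<le> (1 + L * r\<^sup>2) ^ n * k * norm_c z"
        by (intro norm_c_le) (auto simp: dominated_def)
      also have "\<dots> \<le> exp L * k * norm_c z"
      proof (intro mult_right_mono)
        have "(1 + L * r\<^sup>2) ^ n \<le> exp (L * r\<^sup>2) ^ n"
          using L by (intro power_mono exp_ge_add_one_self) (auto intro: add_nonneg_nonneg)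
        also have "\<dots> = exp L" using n by (simp add: r flip: exp_of_nat_mult)
        finally show "(1 + L * r\<^sup>2) ^ n \<le> exp L" .
      qed (use X in \<open>auto simp: dominated_def norm_c_nonneg\<close>)
      finally show "norm_c (\<Sum>j\<le>n. scaleC (\<zeta> ^ j) (scaleC (of_nat (n choose j)) ((D ^^ j) X z))) \<le> b"
        by (simp add: expand b_def mult.commute)
    qed (use r in simp)
    then show ?thesis by (simp add: norm_c_scaleC mult_ac flip: r(3))
  qed
  have "norm_c (D X z) = 0"
  proof (rule ccontr)
    define N where "N = norm_c (D X z)"
    assume "norm_c (D X z) \<noteq> 0"
    then have N: "0 < N" using norm_c_nonneg[of "D X z"] by (simp add: N_def)
    \<comment> \<open>Three demands: positive degree, radius at most \<open>\<epsilon>\<close>, and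
      \<open>sqrt n\<close> beyond \<open>b / N\<close>.\<close>
    obtain n :: nat where n: "max 1 (max (1 / \<epsilon>\<^sup>2) ((b / N)\<^sup>2)) < n"
      using reals_Archimedean2 by blast
    then have "sqrt n * N \<le> b" unfolding N_def by (intro est) auto
    moreover have "b / N < sqrt n"
      using n by (intro real_less_rsqrt) auto
    ultimately show False using N by (simp add: field_simps)
  qed
  then show ?thesis by (rule norm_c_eq_0_imp)
qed

section \<open>Bounds for intertwiners of central operators\<close>

lemma dominated_central_op:
  assumes "0 < c" "centrally_bounded c A"
  shows "dominated c (central_op A)"
  using assms by (intro dominated_mono modulus_central_op_le) auto

lemma dominated_intertwiner:
  assumes c: "0 < c" "centrally_bounded c A" "centrally_bounded c C" and X: "dominated k X"
  shows "dominated (2 * c * k) (intertwiner (central_op A) (central_op C) X)"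
proof -
  have "dominated (c * k + cmod (- 1) * (k * c))
      (\<lambda>z. central_op A (X z) + scaleC (- 1) (X (central_op C z)))"
    by (intro dominated_add dominated_scaleC dominated_compose X dominated_central_op c)
  then show ?thesis by (simp add: intertwiner_def[abs_def] algebra_simps)
qed

text \<open>\<open>X + \<zeta> (A X - X C) = (I + \<zeta> A) X (I - \<zeta> C) + \<zeta>\<^sup>2 A X C\<close>\<close>

lemma dominated_perturbation:
  assumes c: "0 < c" "centrally_bounded c A" "centrally_bounded c C"
    and X: "clinear X" "dominated k X"
    and main: "dominated l (\<lambda>z. X (z - scaleC \<zeta> (central_op C z))
      + scaleC \<zeta> (central_op A (X (z - scaleC \<zeta> (central_op C z)))))"
  shows "dominated (l + (cmod \<zeta>)\<^sup>2 * c\<^sup>2 * k)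
    (\<lambda>z. X z + scaleC \<zeta> (intertwiner (central_op A) (central_op C) X z))"
proof -
  have "dominated (l + cmod (\<zeta>\<^sup>2) * (c * (k * c)))
      (\<lambda>z. X (z - scaleC \<zeta> (central_op C z))
        + scaleC \<zeta> (central_op A (X (z - scaleC \<zeta> (central_op C z))))
        + scaleC (\<zeta>\<^sup>2) (central_op A (X (central_op C z))))"
    by (intro dominated_add main dominated_scaleC dominated_compose X dominated_central_op c)
  then show ?thesis
    by (simp add: intertwiner_def clinear_simps[OF X(1)] clinear_simps[OF clinear_central_op]
        scaleC_simps norm_mult power2_eq_square mult_ac algebra_simps)
qed

text \<open>With \<open>a = c^2 s^2\<close>, the factors \<open>I + i s A\<close> and
  \<open>I - i s C\<close> cost \<open>1 + a\<close> each and the remainder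
  \<open>\<zeta>^2 A X C\<close> costs another \<open>a\<close>. As \<open>a \<le> 1\<close>,
  \<open>(1 + a)^2 + a \<le> 1 + 4 a\<close>, whence the 4.\<close>

lemma dominated_imaginary_perturbation:
  assumes c: "0 < c" "centrally_bounded c A" "centrally_bounded c C" "\<bar>s\<bar> * c \<le> 1"
    and X: "clinear X" "dominated k X"
  shows "dominated ((1 + 4 * c\<^sup>2 * s\<^sup>2) * k)
    (\<lambda>z. X z + scaleC (\<i> * of_real s) (intertwiner (central_op A) (central_op C) X z))"
proof -
  define a where "a = c\<^sup>2 * s\<^sup>2"
  have unit: "dominated (1 + c\<^sup>2 * t\<^sup>2) (\<lambda>z. z + scaleC (\<i> * of_real t) (central_op B z))"
    if "centrally_bounded c B" for B t
    using that c(1) by (intro dominated_mono modulus_ident_plus_imaginary_central_le) auto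
  have "dominated ((1 + c\<^sup>2 * s\<^sup>2) * (k * (1 + c\<^sup>2 * (- s)\<^sup>2)))
      (\<lambda>z. X (z + scaleC (\<i> * of_real (- s)) (central_op C z))
        + scaleC (\<i> * of_real s) (central_op A (X (z + scaleC (\<i> * of_real (- s)) (central_op C z)))))"
    by (rule dominated_compose[OF unit[OF c(2)] dominated_compose[OF X(2) unit[OF c(3)]]])
  then have "dominated ((1 + a) * (k * (1 + a)) + (cmod (\<i> * of_real s))\<^sup>2 * c\<^sup>2 * k)
      (\<lambda>z. X z + scaleC (\<i> * of_real s) (intertwiner (central_op A) (central_op C) X z))"
    by (intro dominated_perturbation c X) (simp add: a_def)
  moreover have "(1 + a) * (k * (1 + a)) + (cmod (\<i> * of_real s))\<^sup>2 * c\<^sup>2 * k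
      \<le> (1 + 4 * c\<^sup>2 * s\<^sup>2) * k"
  proof -
    have "a = (\<bar>s\<bar> * c)\<^sup>2" by (simp add: a_def power_mult_distrib mult.commute)
    then have "0 \<le> a" "a \<le> 1" using c by (auto simp: abs_square_le_1)
    then have "a * a \<le> a" by (simp add: mult_left_le)
    then have "(1 + a) * (1 + a) + a \<le> 1 + 4 * a" by (simp add: algebra_simps)
    moreover have "0 \<le> k" using X by (simp add: dominated_def)
    ultimately have "((1 + a) * (1 + a) + a) * k \<le> (1 + 4 * a) * k" by (rule mult_right_mono)
    then show ?thesis by (simp add: a_def norm_mult algebra_simps)
  qed
  ultimately show ?thesis by (rule dominated_weaken)
qed

end

section \<open>Commutativity of the centre\<close>

interpretation modulus_gauge: gauge modulus
  by standard (auto intro: modulus_nonneg modulus_triangle norm_c_mono)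

interpretation norm_gauge: gauge norm_c
  by standard (auto intro: norm_c_nonneg norm_c_triangle norm_c_mono)

text \<open>For real \<open>s\<close> the factors of \<open>(I + s A) X (I - s A)\<close> are positive, and their product
  \<open>I - s\<^sup>2 A\<^sup>2\<close> is at most \<open>(1 + c\<^sup>2 s\<^sup>2) I\<close>.\<close>

lemma modulus_dominated_real_perturbation:
  fixes A :: "'a::dedekind_complete_banach_lattice regop"
  assumes c: "0 < c" "centrally_bounded c A" "\<bar>s\<bar> * c \<le> 1"
    and X: "clinear X" "modulus_gauge.dominated k X"
  shows "modulus_gauge.dominated ((1 + 4 * c\<^sup>2 * s\<^sup>2) * k)
    (\<lambda>z. X z + scaleC (of_real s) (intertwiner (central_op A) (central_op A) X z))"
proof -
  have k: "0 \<le> k" using X by (simp add: modulus_gauge.dominated_def)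
  define P where "P s x = x + s *\<^sub>R app_regop A x" for s x
  have P: "positive_operator (P s)" "positive_operator (P (- s))"
    unfolding P_def using c by (intro positive_operator_ident_plus_central[where c = c]; simp)+
  have lift_P: "z + scaleC (of_real t) (central_op A z) = lift_op (P t) z" for t z
    by (rule complexification.expand) (simp add: P_def)
  have square: "- (s\<^sup>2 *\<^sub>R app_regop A (app_regop A w)) \<le> (c\<^sup>2 * s\<^sup>2) *\<^sub>R w" if "0 \<le> w" for w
  proof -
    \<comment> \<open>Embeds \<open>w\<close> as an element of modulus \<open>w\<close>, so that the
      modulus bound for \<open>central_op A\<close>, applied twice, gives
      \<open>- A^2 w \<le> c^2 w\<close>.\<close>
    define v where "v = Complexify w 0"
    have w: "modulus v = w"
    proof (rule order.antisym)
      show "modulus v \<le> w"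
        using scaleR_right_mono[OF cos_le_one that]
        by (intro modulus_least) (simp add: v_def)
      show "w \<le> modulus v" using parts_le_modulus(1)[of v] by (simp add: v_def)
    qed
    have "- app_regop A (app_regop A w) \<le> modulus (central_op A (central_op A v))"
      using parts_le_modulus(2)[of "central_op A (central_op A v)"] by (simp add: v_def)
    also have "\<dots> \<le> c *\<^sub>R modulus (central_op A v)" by (rule modulus_central_op_le[OF c(1,2)])
    also have "\<dots> \<le> c *\<^sub>R (c *\<^sub>R w)"
      using modulus_central_op_le[OF c(1,2), of v] c(1) w by (intro scaleR_left_mono) auto
    finally have "s\<^sup>2 *\<^sub>R (- app_regop A (app_regop A w)) \<le> s\<^sup>2 *\<^sub>R (c *\<^sub>R (c *\<^sub>R w))"
      by (intro scaleR_left_mono) auto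
    then show ?thesis by (simp add: power2_eq_square mult_ac)
  qed
  have "modulus_gauge.dominated (k * (1 + c\<^sup>2 * s\<^sup>2)) (\<lambda>z. lift_op (P s) (X (lift_op (P (- s)) z)))"
    unfolding modulus_gauge.dominated_def
  proof (intro conjI allI)
    fix z :: "'a complexification"
    define w where "w = modulus z"
    have "modulus (lift_op (P s) (X (lift_op (P (- s)) z))) \<le> P s (modulus (X (lift_op (P (- s)) z)))"
      by (rule modulus_lift_op_le[OF P(1)])
    \<comment> \<open>The pointwise bound on \<open>X\<close> replaces it by the scalar
      \<open>k\<close> under the positive \<open>P s\<close>, which brings the two positive factors
      together.\<close>
    also have "\<dots> \<le> P s (k *\<^sub>R P (- s) w)"
    proof (rule positive_operator_mono[OF P(1)])
      have "modulus (X (lift_op (P (- s)) z)) \<le> k *\<^sub>R modulus (lift_op (P (- s)) z)"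
        using X by (simp add: modulus_gauge.dominated_def)
      also have "\<dots> \<le> k *\<^sub>R P (- s) w"
        unfolding w_def by (intro scaleR_left_mono modulus_lift_op_le P k)
      finally show "modulus (X (lift_op (P (- s)) z)) \<le> k *\<^sub>R P (- s) w" .
    qed
    \<comment> \<open>Both factors come from the same \<open>A\<close>, so the terms linear in
      \<open>s\<close> cancel.\<close>
    also have "\<dots> = k *\<^sub>R (w + - (s\<^sup>2 *\<^sub>R app_regop A (app_regop A w)))"
      by (simp add: P_def app_regop_simps scaleR_diff_right scaleR_add_right power2_eq_square mult_ac)
    also have "\<dots> \<le> k *\<^sub>R (w + (c\<^sup>2 * s\<^sup>2) *\<^sub>R w)"
      by (intro scaleR_left_mono add_left_mono square k) (simp add: w_def modulus_nonneg)
    finally show "modulus (lift_op (P s) (X (lift_op (P (- s)) z)))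
        \<le> (k * (1 + c\<^sup>2 * s\<^sup>2)) *\<^sub>R modulus z"
      by (simp add: w_def algebra_simps)
  qed (use k in simp)
  then have "modulus_gauge.dominated (k * (1 + c\<^sup>2 * s\<^sup>2) + (cmod (of_real s))\<^sup>2 * c\<^sup>2 * k)
      (\<lambda>z. X z + scaleC (of_real s) (intertwiner (central_op A) (central_op A) X z))"
    by (intro modulus_gauge.dominated_perturbation c X) (simp flip: lift_P)
  \<comment> \<open>The left side is \<open>(1 + 2 c^2 s^2) k\<close>; the 4 matches the imaginary
    perturbation, so that one \<open>K\<close> covers both directions.\<close>
  moreover have "k * (1 + c\<^sup>2 * s\<^sup>2) + (cmod (of_real s))\<^sup>2 * c\<^sup>2 * k \<le> (1 + 4 * c\<^sup>2 * s\<^sup>2) * k"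
  proof -
    have "0 \<le> c\<^sup>2 * s\<^sup>2 * k" using k by simp
    then show ?thesis by (simp add: algebra_simps)
  qed
  ultimately show ?thesis by (rule modulus_gauge.dominated_weaken)
qed

lemma clinear_add_scaleC:
  "clinear X \<Longrightarrow> clinear Y \<Longrightarrow> clinear (\<lambda>z. X z + scaleC \<zeta> (Y z))"
  unfolding clinear_iff by (simp add: scaleC_simps mult.commute)

lemma clinear_intertwiner:
  "clinear U \<Longrightarrow> clinear V \<Longrightarrow> clinear X \<Longrightarrow> clinear (intertwiner U V X)"
  unfolding clinear_iff intertwiner_def by (simp add: scaleC_simps)

text \<open>\<open>B\<close> is itself dominated in modulus, so the vanishing argument for
  \<open>X \<mapsto> A X - X A\<close> applies to \<open>X = B\<close>.\<close>

lemma central_op_commute: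
  fixes A B :: "'a::dedekind_complete_banach_lattice regop"
  assumes c: "1 \<le> c" and A: "centrally_bounded c A" and B: "centrally_bounded c B"
  shows "central_op A (central_op B z) = central_op B (central_op A z)"
proof -
  have c': "0 < c" "\<bar>s\<bar> * c \<le> 1" if "\<bar>s\<bar> \<le> 1 / c" for s
    using c that by (auto simp: field_simps)
  have "intertwiner (central_op A) (central_op A) (central_op B) z = 0"
  \<comment> \<open>\<open>\<epsilon> = 1 / c\<close> is at most 1 and ensures
    \<open>|s| c \<le> 1\<close>; \<open>M = 2 c\<close> comes from
    \<open>dominated_intertwiner\<close>.\<close>
  proof (rule modulus_gauge.intertwiner_eq_0[where W = "Collect clinear" and \<epsilon> = "1 / c"
        and K = "4 * c\<^sup>2" and M = "2 * c" and k = c])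
    show "modulus_gauge.dominated c (central_op B)"
      using c B by (intro modulus_gauge.dominated_central_op) auto
  qed (use c A c' in \<open>auto intro: clinear_central_op clinear_intertwiner clinear_add_scaleC
      modulus_dominated_real_perturbation modulus_gauge.dominated_imaginary_perturbation
      modulus_gauge.dominated_intertwiner\<close>)
  then show ?thesis by (simp add: intertwiner_def)
qed

section \<open>Intertwining relations\<close>

lemma central_op_uminus: "central_op (- A) z = - central_op A z"
  by (rule complexification.expand) (simp add: uminus_regop.rep_eq)

text \<open>On the space of all \<open>X\<close> with \<open>P X = - i Q X\<close>, where \<open>P X = A X - X C\<close> and \<open>Q X = B X - X D\<close>,
  the perturbation \<open>I + s P = I - i s Q\<close> is an imaginary one for real \<open>s\<close>. This space is invariant
  under \<open>P\<close> because \<open>P\<close> and \<open>Q\<close> commute.\<close>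

lemma central_intertwining_real_part:
  fixes A B C D :: "'a::dedekind_complete_banach_lattice regop"
  assumes c: "1 \<le> c" "centrally_bounded c A" "centrally_bounded c B" "centrally_bounded c C"
      "centrally_bounded c D"
    and \<Xi>: "clinear \<Xi>" "norm_gauge.dominated k \<Xi>"
    and eq: "\<And>z. intertwiner (central_op A) (central_op C) \<Xi> z
      + scaleC \<i> (intertwiner (central_op B) (central_op D) \<Xi> z) = 0"
  shows "intertwiner (central_op A) (central_op C) \<Xi> z = 0"
proof -
  let ?P = "intertwiner (central_op A) (central_op C)"
  let ?Q = "intertwiner (central_op B) (central_op D)"
  define W where "W = {X. clinear X \<and> (\<forall>z. ?P X z + scaleC \<i> (?Q X z) = 0)}"
  have c': "0 < c" "\<bar>s\<bar> * c \<le> 1" if "\<bar>s\<bar> \<le> 1 / c" for s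
    using c that by (auto simp: field_simps)
  have W_lin: "clinear X" if "X \<in> W" for X using that by (simp add: W_def)
  \<comment> \<open>Left and right multiplications commute by associativity; what remains is
    \<open>A B = B A\<close> and \<open>C D = D C\<close>.\<close>
  have commute: "?Q (?P X) z = ?P (?Q X) z" if "clinear X" for X z
    using central_op_commute[OF c(1,2,3)] central_op_commute[OF c(1,4,5)]
    by (simp add: intertwiner_def clinear_simps[OF that] clinear_simps[OF clinear_central_op]
        algebra_simps)
  have P_W: "?P X \<in> W" if X: "X \<in> W" for X
  proof -
    have "?P (?P X) z + scaleC \<i> (?Q (?P X) z) = 0" for z
    proof -
      have "?P (?P X) z + scaleC \<i> (?P (?Q X) z) = ?P (\<lambda>z. ?P X z + scaleC \<i> (?Q X z)) z"
        by (simp add: intertwiner_add_scaleC[OF clinear_central_op])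
      also have "(\<lambda>z. ?P X z + scaleC \<i> (?Q X z)) = (\<lambda>z. 0)" using X by (simp add: W_def)
      also have "?P (\<lambda>z. 0) z = 0"
        using clinear_simps(3)[OF clinear_central_op, of A 0 0] by (simp add: intertwiner_def)
      finally show ?thesis by (simp add: commute[OF W_lin[OF X]])
    qed
    then show ?thesis
      using X by (simp add: W_def clinear_intertwiner clinear_central_op)
  qed
  show ?thesis
  proof (rule norm_gauge.intertwiner_eq_0[where W = W and \<epsilon> = "1 / c"
        and K = "4 * c\<^sup>2" and M = "2 * c" and k = k])
    show "(\<lambda>z. X z + scaleC \<zeta> (Y z)) \<in> W" if X: "X \<in> W" and Y: "Y \<in> W" for X Y \<zeta>
    proof -
      have "?P X z + scaleC \<zeta> (?P Y z) + scaleC \<i> (?Q X z + scaleC \<zeta> (?Q Y z)) = 0" for z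
      proof -
        have "?P X z + scaleC \<zeta> (?P Y z) + scaleC \<i> (?Q X z + scaleC \<zeta> (?Q Y z))
            = (?P X z + scaleC \<i> (?Q X z)) + scaleC \<zeta> (?P Y z + scaleC \<i> (?Q Y z))"
          by (simp add: scaleC_simps mult.commute)
        also have "\<dots> = 0" using X Y by (simp add: W_def)
        finally show ?thesis .
      qed
      then show ?thesis
        using X Y by (simp add: W_def clinear_add_scaleC intertwiner_add_scaleC clinear_central_op)
    qed
    show "norm_gauge.dominated ((1 + 4 * c\<^sup>2 * s\<^sup>2) * k) (\<lambda>z. X z + scaleC (of_real s) (?P X z))"
      if X: "X \<in> W" "norm_gauge.dominated k X" and s: "\<bar>s\<bar> \<le> 1 / c" for X k s
    proof -
      have "scaleC (of_real s) (?P X z) = scaleC (\<i> * of_real (- s)) (?Q X z)" for z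
      proof -
        have "?P X z = - scaleC \<i> (?Q X z)"
          using X by (simp add: W_def eq_neg_iff_add_eq_0)
        then show ?thesis by (simp add: mult.commute)
      qed
      moreover have "norm_gauge.dominated ((1 + 4 * c\<^sup>2 * (- s)\<^sup>2) * k)
          (\<lambda>z. X z + scaleC (\<i> * of_real (- s)) (?Q X z))"
        using c' s c W_lin X by (intro norm_gauge.dominated_imaginary_perturbation) auto
      ultimately show ?thesis by simp
    qed
    show "norm_gauge.dominated ((1 + 4 * c\<^sup>2 * s\<^sup>2) * k)
        (\<lambda>z. X z + scaleC (\<i> * of_real s) (?P X z))"
      if "X \<in> W" "norm_gauge.dominated k X" "\<bar>s\<bar> \<le> 1 / c" for X k s
      using c' c W_lin that by (intro norm_gauge.dominated_imaginary_perturbation) auto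
    show "norm_gauge.dominated (2 * c * k) (?P X)" if "X \<in> W" "norm_gauge.dominated k X" for X k
      using c that by (intro norm_gauge.dominated_intertwiner) auto
    show "\<Xi> \<in> W" using \<Xi> eq by (simp add: W_def)
  qed (use c \<Xi> in \<open>auto simp: P_W clinear_central_op\<close>)
qed

section \<open>Real and imaginary parts of operators in the centre\<close>

lemma app_c_eq:
  "app_c T z = central_op (re_part T) z + scaleC \<i> (central_op (im_part T) z)"
  by (rule complexification.expand) (simp add: app_c_def)

text \<open>Bounds for all large \<open>d\<close> let the four parts of \<open>S\<close> and
  \<open>T\<close> share one constant that is at least 1.\<close>

lemma centre_imp_centrally_bounded:
  assumes "T \<in> centre"
  shows "\<exists>c. \<forall>d\<ge>c. centrally_bounded d (re_part T) \<and> centrally_bounded d (im_part T)"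
proof -
  obtain c where c: "modulus T \<le> c *\<^sub>R id_regop" using assms by (auto simp: centre_def)
  have id: "0 \<le> (id_regop :: 'a regop)"
    by (simp add: less_eq_regop.rep_eq zero_regop.rep_eq id_regop.rep_eq)
  have "modulus T \<le> d *\<^sub>R id_regop" if "c \<le> d" for d
    using c scaleR_right_mono[OF that id] by (rule order_trans)
  then show ?thesis
    unfolding centrally_bounded_def using parts_le_modulus[of T] by (meson order_trans)
qed

text \<open>Conjugation replaces the angle \<theta> by its negative, which
  \<open>cos_sin_le_modulus\<close> also covers.\<close>

lemma centre_cnj_c:
  assumes "T \<in> centre"
  shows "cnj_c T \<in> centre"
proof -
  have "modulus (cnj_c T) \<le> modulus T"
  proof (rule modulus_least)
    fix \<theta>
    show "cos \<theta> *\<^sub>R re_part (cnj_c T) + sin \<theta> *\<^sub>R im_part (cnj_c T) \<le> modulus T"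
      using cos_sin_le_modulus[of "- \<theta>" T] by (simp add: cnj_c_def)
  qed
  then show ?thesis using assms unfolding centre_def by (auto intro: order_trans)
qed

text \<open>The hypothesis reads \<open>P \<Xi> + i Q \<Xi> = 0\<close>. Since
  \<open>P \<Xi> = 0\<close>, also \<open>Q \<Xi> = 0\<close>, and
  \<open>P \<Xi> - i Q \<Xi> = 0\<close> is the conjugate relation.\<close>

lemma centre_intertwining_imp_cnj:
  fixes S T :: "'a::dedekind_complete_banach_lattice regop complexification"
  assumes "S \<in> centre" and "T \<in> centre" and lin: "clinear \<Xi>"
    and "\<exists>K. \<forall>z. norm_c (\<Xi> z) \<le> K * norm_c z"
    and eq: "app_c S \<circ> \<Xi> = \<Xi> \<circ> app_c T"
  shows "app_c (cnj_c S) \<circ> \<Xi> = \<Xi> \<circ> app_c (cnj_c T)"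
proof -
  obtain c1 c2 where c12: "\<forall>d\<ge>c1. centrally_bounded d (re_part S) \<and> centrally_bounded d (im_part S)"
    "\<forall>d\<ge>c2. centrally_bounded d (re_part T) \<and> centrally_bounded d (im_part T)"
    using centre_imp_centrally_bounded assms(1,2) by metis
  define c where "c = max 1 (max c1 c2)"
  have c: "1 \<le> c" "centrally_bounded c (re_part S)" "centrally_bounded c (im_part S)"
    "centrally_bounded c (re_part T)" "centrally_bounded c (im_part T)"
    using c12 by (auto simp: c_def)
  obtain K where K: "norm_c (\<Xi> z) \<le> K * norm_c z" for z using assms(4) by blast
  \<comment> \<open>\<open>dominated\<close> demands a nonnegative constant.\<close>
  have "norm_c (\<Xi> z) \<le> \<bar>K\<bar> * norm_c z" for z
    using K[of z] mult_right_mono[OF abs_ge_self norm_c_nonneg] by (rule order_trans)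
  then have bound: "norm_gauge.dominated \<bar>K\<bar> \<Xi>" by (simp add: norm_gauge.dominated_def)
  let ?P = "intertwiner (central_op (re_part S)) (central_op (re_part T)) \<Xi>"
  let ?Q = "intertwiner (central_op (im_part S)) (central_op (im_part T)) \<Xi>"
  have PQ: "?P z + scaleC \<i> (?Q z) = 0" for z
    using fun_cong[OF eq, of z]
    by (simp add: app_c_eq intertwiner_def clinear_simps[OF lin] scaleC_simps algebra_simps)
  have P: "?P z = 0" for z
    by (rule central_intertwining_real_part[OF c lin bound PQ])
  then have "scaleC \<i> (?Q z) = 0" for z using PQ[of z] by simp
  then have "?P z - scaleC \<i> (?Q z) = 0" for z using P by simp
  then show ?thesis
    by (intro ext)
      (simp add: app_c_eq cnj_c_def central_op_uminus intertwiner_def clinear_simps[OF lin]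
        scaleC_simps algebra_simps)
qed

theorem theorem3p7:
  fixes S T :: "'a::dedekind_complete_banach_lattice regop complexification"
    and \<Xi> :: "'a complexification \<Rightarrow> 'a complexification"
  assumes "S \<in> centre" and "T \<in> centre"
    and "Vector_Spaces.linear scaleC scaleC \<Xi>"
    and "\<exists>K. \<forall>z. norm_c (\<Xi> z) \<le> K * norm_c z"
  shows "app_c S \<circ> \<Xi> = \<Xi> \<circ> app_c T \<longleftrightarrow> app_c (cnj_c S) \<circ> \<Xi> = \<Xi> \<circ> app_c (cnj_c T)"
proof
  \<comment> \<open>Conjugation is an involution preserving the centre, so the converse is the same
    implication for the conjugates.\<close>
  assume "app_c (cnj_c S) \<circ> \<Xi> = \<Xi> \<circ> app_c (cnj_c T)"
  then have "app_c (cnj_c (cnj_c S)) \<circ> \<Xi> = \<Xi> \<circ> app_c (cnj_c (cnj_c T))"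
    by (rule centre_intertwining_imp_cnj[OF assms(1,2)[THEN centre_cnj_c] assms(3,4)])
  then show "app_c S \<circ> \<Xi> = \<Xi> \<circ> app_c T" by (simp add: cnj_c_def)
qed (rule centre_intertwining_imp_cnj[OF assms])

end
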